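(* There exists $K_0$ such that for every even integer $k \geq K_0$ and every integer $m$ with $1\leq m \leq \frac{(k-1)^2}{16\pi^2}$ one has $v_\infty\left(P_{k,m,1}\right) = 1$; in particular $P_{k,m,1}\not\equiv 0$.
   Context: For positive integers $k,m,N$ with $k$ even, $P_{k,m,N}$ denotes the Poincaré series of weight $k$ and index $m$ at the cusp $i\infty$ for $\Gamma_0(N)=\{\begin{pmatrix}a&b\\c&d\end{pmatrix}\in \mathrm{SL}_2(\mathbb{Z}) : N\mid c\}$: $$P_{k,m,N}(z)=\sum_{\gamma\in\Gamma_\infty\backslash\Gamma_0(N)} j(\gamma,z)^{-k} e(m\gamma z),$$ where $\Gamma_\infty=\{\begin{pmatrix}1&*\\0&1\end{pmatrix}\in\mathrm{SL}_2(\mathbb{Z})\}$, $j(\begin{pmatrix}a&b\\c&d\end{pmatrix},z)=cz+d$ and $e(z)=e^{2\pi i z}$. It has a Fourier expansion $P_{k,m,N}(z)=\sum_{n\geq1} p_{k,N}(m;n)e(nz)$, and $v_\infty(f)$ denotes the order of vanishing of $f$ at the cusp $i\infty$, i.e. the least $n\ge 1$ with nonzero $n$-th Fourier coefficient. *)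

theory Defs
  imports "HOL-Analysis.Analysis"
begin

definition e :: "complex \<Rightarrow> complex" where
  "e z = exp (2 * of_real pi * \<i> * z)"

text \<open>Cosets Gamma_infty \ Gamma_0(N) (Gamma_infty without -I) correspond bijectively to
  the bottom rows (c,d) with gcd(c,d)=1 and N dvd c.  For such a row we pick an upper row (a,b)
  with ad-bc=1; the value of e(m gamma z) does not depend on this choice.\<close>
definition upper_row :: "int \<Rightarrow> int \<Rightarrow> int \<times> int" where
  "upper_row c d = (SOME (a,b). a * d - b * c = 1)"

definition moeb :: "int \<Rightarrow> int \<Rightarrow> int \<Rightarrow> int \<Rightarrow> complex \<Rightarrow> complex" where
  "moeb a b c d z = (of_int a * z + of_int b) / (of_int c * z + of_int d)"

definition bottom_rows :: "nat \<Rightarrow> (int \<times> int) set" where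
  "bottom_rows N = {(c,d). coprime c d \<and> int N dvd c}"

definition poincare :: "nat \<Rightarrow> int \<Rightarrow> nat \<Rightarrow> complex \<Rightarrow> complex" where
  "poincare k m N z =
     (\<Sum>\<^sub>\<infinity>(c,d)\<in>bottom_rows N.
        inverse ((of_int c * z + of_int d) ^ k) *
        e (of_int m * moeb (fst (upper_row c d)) (snd (upper_row c d)) c d z))"

text \<open>n-th Fourier coefficient of a 1-periodic holomorphic function on the upper half plane,
  computed on the horizontal line Im z = 1.\<close>
definition fourier_coeff :: "(complex \<Rightarrow> complex) \<Rightarrow> int \<Rightarrow> complex" where
  "fourier_coeff f n = integral {0..1} (\<lambda>x::real. f (of_real x + \<i>) * e (- of_int n * (of_real x + \<i>)))"

definition v_infty :: "(complex \<Rightarrow> complex) \<Rightarrow> nat" where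
  "v_infty f = (LEAST n::nat. n \<ge> 1 \<and> fourier_coeff f (int n) \<noteq> 0)"

end

theory Submission
  imports Defs "HOL-Complex_Analysis.Complex_Analysis"
begin

text \<open>
  Write $k = n + 1$, $A(\mu) = (-2\pi i)^k F_n(4\pi^2\mu)$ with $F_n(t) = \sum_j (-t)^j / (j!\,(n+j)!)$,
  the Bessel function $J_n(x)$ divided by $(x/2)^n$ at $t = x^2/4$. Integrating the Poincare series
  termwise, the rows $(c,d)$ with fixed $c \neq 0$ contribute to the first Fourier coefficient at most
  $|c|^{-n} |A(m/c^2)|$ in absolute value, exactly $A(m)$ for $c = \pm 1$, and the rows with $c = 0$
  contribute $2\delta_{m,1}$.

  For $t = 4\pi^2 m \le n^2/4$ the three-term recurrence of $F_n$ gives $-F_n' = F_{n+1} \le \frac{2}{n+1} F_n$,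
  so $n!\,F_n(t) \ge e^{-2t/(n+1)} \ge e^{-n/2}$, whereas the rows with $|c| \ge 2$ are
  bounded, up to the same factor $(2\pi)^k/n!$, by a constant times $2^{-n} e^{t/(4(n+1))} \le 2^{-n} e^{n/16}$.
  As $e^{9/16} < 2$, the rows with $|c| = 1$ dominate for large $n$. If $m = 1$, everything except
  the term $2$ coming from $c = 0$ tends to $0$.
\<close>

section \<open>The Bessel series\<close>

definition bessel_coeff :: "nat \<Rightarrow> nat \<Rightarrow> real" where
  "bessel_coeff n j = (-1) ^ j / (fact j * fact (n + j))"

definition bessel_F :: "nat \<Rightarrow> real \<Rightarrow> real" where
  "bessel_F n t = (\<Sum>j. bessel_coeff n j * t ^ j)"

lemma fact_add_ge: "fact n * (real n + 1) ^ j \<le> fact (n + j)"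
proof (induction j)
  case (Suc j)
  have "fact n * (real n + 1) ^ Suc j = (fact n * (real n + 1) ^ j) * (real n + 1)"
    by simp
  also have "\<dots> \<le> fact (n + j) * (real n + real j + 1)"
    using Suc by (intro mult_mono) auto
  also have "\<dots> = fact (n + Suc j)"
    by (simp add: algebra_simps)
  finally show ?case .
qed simp

text \<open>The series is majorised by an exponential series in |t| / (n+1). Keeping n+1 in the
  denominator makes the later exponents of size O(n) when t is of size n^2.\<close>

lemma norm_bessel_coeff_le:
  "\<bar>bessel_coeff n j * t ^ j\<bar> \<le> (\<bar>t\<bar> / (real n + 1)) ^ j / fact j / fact n"
proof -
  have "\<bar>bessel_coeff n j * t ^ j\<bar> = \<bar>t\<bar> ^ j / (fact j * fact (n + j))"
    by (simp add: bessel_coeff_def abs_mult power_abs)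
  also have "\<dots> \<le> \<bar>t\<bar> ^ j / (fact j * (fact n * (real n + 1) ^ j))"
    using fact_add_ge[of n j] by (intro divide_left_mono mult_left_mono mult_pos_pos) auto
  also have "\<dots> = (\<bar>t\<bar> / (real n + 1)) ^ j / fact j / fact n"
    by (simp add: power_divide)
  finally show ?thesis .
qed

lemma exp_majorant_sums: "(\<lambda>j. (x::real) ^ j / fact j / c) sums (exp x / c)"
  using exp_converges[of x] by (intro sums_divide) (simp add: divide_inverse mult.commute)

lemma summable_bessel_F: "summable (\<lambda>j. bessel_coeff n j * t ^ j)"
  using norm_bessel_coeff_le
  by (intro summable_comparison_test[OF _ sums_summable[OF exp_majorant_sums]])
     (auto intro!: exI[of _ 0])

lemma abs_bessel_F_le: "\<bar>bessel_F n t\<bar> \<le> exp (\<bar>t\<bar> / (real n + 1)) / fact n"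
  unfolding bessel_F_def sums_unique[OF exp_majorant_sums]
  using norm_suminf_le[OF _ sums_summable[OF exp_majorant_sums],
      of "\<lambda>j. bessel_coeff n j * t ^ j" "\<bar>t\<bar> / (real n + 1)" "fact n"] norm_bessel_coeff_le
  by simp

lemma bessel_F_0: "bessel_F n 0 = 1 / fact n"
  unfolding bessel_F_def powser_zero by (simp add: bessel_coeff_def)

text \<open>Only the constant term 1/n! is split off, and the rest is majorised as before. This
  gives two-sided control of \<open>bessel_F\<close> when t is small against n, which starts the
  downward induction below.\<close>

lemma bessel_F_diff_le: "\<bar>bessel_F n t - 1 / fact n\<bar> \<le> (exp (\<bar>t\<bar> / (real n + 1)) - 1) / fact n"
proof -
  let ?g = "\<lambda>j. (\<bar>t\<bar> / (real n + 1)) ^ j / fact j / (fact n :: real)"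
  have g: "?g sums (exp (\<bar>t\<bar> / (real n + 1)) / fact n)"
    by (rule exp_majorant_sums)
  have g': "(\<lambda>j. ?g (Suc j)) sums (exp (\<bar>t\<bar> / (real n + 1)) / fact n - 1 / fact n)"
    using g by (subst sums_Suc_iff) simp
  have "bessel_F n t - 1 / fact n = (\<Sum>j. bessel_coeff n (Suc j) * t ^ Suc j)"
    unfolding bessel_F_def
    by (subst suminf_split_head[OF summable_bessel_F]) (simp add: bessel_coeff_def)
  also have "\<bar>\<dots>\<bar> \<le> (\<Sum>j. ?g (Suc j))"
    using norm_suminf_le[OF _ sums_summable[OF g'], of "\<lambda>j. bessel_coeff n (Suc j) * t ^ Suc j"]
      norm_bessel_coeff_le[of n "Suc _" t]
    by (simp only: real_norm_def)
  also have "\<dots> = (exp (\<bar>t\<bar> / (real n + 1)) - 1) / fact n"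
    using sums_unique[OF g'] by (simp add: diff_divide_distrib)
  finally show ?thesis .
qed

section \<open>Derivative, recurrence and lower bound of the Bessel series\<close>

lemma has_real_derivative_bessel_F:
  "(bessel_F n has_real_derivative - bessel_F (Suc n) t) (at t)"
proof -
  have "diffs (bessel_coeff n) j = - bessel_coeff (Suc n) j" for j
    by (simp add: diffs_def bessel_coeff_def divide_simps del: of_nat_Suc)
  then have "(\<Sum>j. diffs (bessel_coeff n) j * t ^ j) = - bessel_F (Suc n) t"
    by (simp add: bessel_F_def suminf_minus[OF summable_bessel_F])
  with termdiffs_strong_converges_everywhere[of "bessel_coeff n" t, OF summable_bessel_F]
  show ?thesis
    by (simp add: bessel_F_def[abs_def])
qed

text \<open>Compare coefficients: the factor n + 1 + j turns the j-th coefficient of index n + 1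
  into that of index n. The share n + 1 of this factor gives the first term, the share j gives the
  second after an index shift.\<close>

lemma bessel_F_recurrence:
  "bessel_F n t = (real n + 1) * bessel_F (Suc n) t - t * bessel_F (Suc (Suc n)) t"
proof -
  \<comment> \<open>The factor j annihilates the term j = 0, so shifting the index loses
    nothing.\<close>
  let ?h = "\<lambda>j. - real j * bessel_coeff (Suc n) j * t ^ j"
  have "(\<lambda>j. t * (bessel_coeff (Suc (Suc n)) j * t ^ j)) sums (t * bessel_F (Suc (Suc n)) t)"
    unfolding bessel_F_def by (intro sums_mult summable_sums summable_bessel_F)
  also have "(\<lambda>j. t * (bessel_coeff (Suc (Suc n)) j * t ^ j)) = (\<lambda>j. ?h (Suc j))"
    by (simp add: bessel_coeff_def fun_eq_iff divide_simps del: of_nat_Suc)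
  finally have "?h sums (t * bessel_F (Suc (Suc n)) t)"
    by (subst (asm) sums_Suc_iff) simp
  moreover have "(\<lambda>j. (real n + 1) * (bessel_coeff (Suc n) j * t ^ j)) sums ((real n + 1) * bessel_F (Suc n) t)"
    unfolding bessel_F_def by (intro sums_mult summable_sums summable_bessel_F)
  ultimately have "(\<lambda>j. (real n + 1) * (bessel_coeff (Suc n) j * t ^ j) - ?h j) sums
      ((real n + 1) * bessel_F (Suc n) t - t * bessel_F (Suc (Suc n)) t)"
    by (intro sums_diff)
  also have "(\<lambda>j. (real n + 1) * (bessel_coeff (Suc n) j * t ^ j) - ?h j) = (\<lambda>j. bessel_coeff n j * t ^ j)"
  proof
    fix j
    have "(real n + 1 + real j) * bessel_coeff (Suc n) j = bessel_coeff n j"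
    proof -
      have "(fact (Suc n + j) :: real) = (real n + 1 + real j) * fact (n + j)"
        by (simp add: algebra_simps)
      then show ?thesis
        by (simp only: bessel_coeff_def) (simp add: divide_simps)
    qed
    moreover have "(real n + 1) * (bessel_coeff (Suc n) j * t ^ j) - ?h j =
        (real n + 1 + real j) * bessel_coeff (Suc n) j * t ^ j"
      by (simp add: algebra_simps)
    ultimately show "(real n + 1) * (bessel_coeff (Suc n) j * t ^ j) - ?h j = bessel_coeff n j * t ^ j"
      by simp
  qed
  finally show ?thesis
    by (simp add: bessel_F_def sums_iff)
qed

text \<open>Downward induction: the bound holds for all large indices, and the recurrence carries it down
  as long as \<open>4 * t \<le> (n + 1) * (n + 2)\<close>.\<close>

lemma bessel_F_ratio:
  assumes t: "0 \<le> t" "4 * t \<le> (real n + 1) * (real n + 2)"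
  shows "0 < bessel_F n t \<and> (real n + 1) * bessel_F (Suc n) t \<le> 2 * bessel_F n t"
proof -
  \<comment> \<open>Starting index of the induction: as N is at least 4t, the exponents t / (N+1)
    and t / (N+2) are at most 1/4.\<close>
  define N where "N = max n (nat \<lceil>4 * t\<rceil>)"
  have N: "n \<le> N" "4 * t \<le> real N"
    unfolding N_def by (simp, linarith)
  define P where "P = (\<lambda>n. 0 < bessel_F n t \<and> (real n + 1) * bessel_F (Suc n) t \<le> 2 * bessel_F n t)"
  \<comment> \<open>The value 4/3 fits the ratio 2: it yields F_N >= (2/3) / N! and (N+1) F_{N+1} <=
    (4/3) / N!.\<close>
  have e14: "exp (1/4) \<le> (4/3 :: real)"
  proof -
    have "3/4 \<le> exp (- (1/4) :: real)"
      using exp_ge_add_one_self[of "- (1/4) :: real"] by simp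
    then show ?thesis
      by (simp add: exp_minus field_simps)
  qed
  have "t / (real N + 1) \<le> 1 / 4" "t / (real (Suc N) + 1) \<le> 1 / 4"
    using N t by (auto simp: divide_simps)
  then have ex: "exp (\<bar>t\<bar> / (real N + 1)) \<le> 4/3" "exp (\<bar>t\<bar> / (real (Suc N) + 1)) \<le> 4/3"
    using e14 t by (smt (verit) exp_le_cancel_iff)+
  have "\<bar>bessel_F N t - 1 / fact N\<bar> \<le> (1/3) / fact N"
    by (rule order_trans[OF bessel_F_diff_le divide_right_mono]) (use ex in auto)
  then have lo: "(2/3) / fact N \<le> bessel_F N t"
    by (simp add: abs_le_iff diff_le_eq)
  have "bessel_F (Suc N) t \<le> (4/3) / fact (Suc N)"
    by (rule order_trans[OF _ order_trans[OF abs_bessel_F_le divide_right_mono[OF ex(2)]]]) auto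
  then have "(real N + 1) * bessel_F (Suc N) t \<le> 2 * ((2/3) / fact N)"
    by (simp add: field_simps del: of_nat_Suc) (simp add: algebra_simps)
  moreover have "0 < (2/3) / (fact N :: real)"
    by simp
  ultimately have base: "P N"
    unfolding P_def using lo by linarith
  from N(1) base t have "P n"
  proof (induction rule: inc_induct)
    case (step n)
    have "4 * t \<le> (real (Suc n) + 1) * (real (Suc n) + 2)"
      using step.prems by (simp add: algebra_simps)
    with step have P: "P (Suc n)"
      by simp
    let ?F = "bessel_F (Suc n) t"
    have F: "0 < ?F" "(real n + 2) * bessel_F (Suc (Suc n)) t \<le> 2 * ?F"
      using P by (auto simp: P_def algebra_simps)
    \<comment> \<open>The bound on t makes the subtracted term of the recurrence at most half of the
      leading term (n+1) F_{n+1}. This gives positivity and the ratio bound for n at once.\<close>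
    have "t * ((real n + 2) * bessel_F (Suc (Suc n)) t) \<le> t * (2 * ?F)"
      using F step.prems by (intro mult_left_mono) auto
    also have "\<dots> \<le> ((real n + 1) * (real n + 2) / 2) * ?F"
      using F mult_right_mono[OF step.prems(3), of ?F] by simp
    finally have "(real n + 2) * (t * bessel_F (Suc (Suc n)) t) \<le> (real n + 2) * ((real n + 1) / 2 * ?F)"
      by (simp add: algebra_simps)
    then have "t * bessel_F (Suc (Suc n)) t \<le> (real n + 1) / 2 * ?F"
      by (subst (asm) mult_le_cancel_left_pos) auto
    then have "(real n + 1) / 2 * ?F \<le> bessel_F n t"
      using bessel_F_recurrence[of n t] by (simp add: field_simps)
    moreover have "0 < (real n + 1) / 2 * ?F"
      using F by simp
    ultimately show ?case
      unfolding P_def by (simp add: algebra_simps)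
  qed
  then show ?thesis
    by (simp add: P_def)
qed

text \<open>A Gronwall argument: since -F_n' = F_{n+1} <= c F_n with c = 2 / (n+1), the product of
  F_n(s) and exp(c s) is nondecreasing on [0,t], and F_n(0) = 1/n!.\<close>

lemma bessel_F_ge:
  assumes t: "0 \<le> t" "4 * t \<le> (real n + 1) * (real n + 2)"
  shows "exp (- 2 * t / (real n + 1)) / fact n \<le> bessel_F n t"
proof -
  define c where "c = 2 / (real n + 1)"
  define h where "h = (\<lambda>s. bessel_F n s * exp (c * s))"
  have "h 0 \<le> h t"
  proof (rule DERIV_nonneg_imp_nondecreasing[OF t(1)])
    fix s assume s: "0 \<le> s" "s \<le> t"
    have "(h has_real_derivative - bessel_F (Suc n) s * exp (c * s) + c * exp (c * s) * bessel_F n s) (at s)"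
      unfolding h_def
      by (rule derivative_eq_intros has_real_derivative_bessel_F refl | simp)+
    moreover have "0 \<le> exp (c * s) * (c * bessel_F n s - bessel_F (Suc n) s)"
      using bessel_F_ratio[of s n] s t
      by (intro mult_nonneg_nonneg) (auto simp: c_def field_simps)
    ultimately show "\<exists>y. (h has_real_derivative y) (at s) \<and> 0 \<le> y"
      by (intro exI conjI) (auto simp: algebra_simps)
  qed
  then show ?thesis
    by (simp add: h_def c_def bessel_F_0 exp_minus field_simps)
qed

section \<open>Line integrals by residues\<close>

lemma higher_deriv_exp_cmult: "(deriv ^^ n) (\<lambda>z::complex. exp (w * z)) z = w ^ n * exp (w * z)"
proof -
  have "(deriv ^^ n) exp = (exp :: complex \<Rightarrow> complex)"
    by (induction n) (auto intro!: DERIV_imp_deriv DERIV_exp)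
  then show ?thesis
    using higher_deriv_compose_linear[of exp UNIV UNIV z w n] by (simp add: holomorphic_on_exp)
qed

lemma contour_integral_exp_over_power:
  "((\<lambda>z. exp (w * z) / z ^ Suc n) has_contour_integral (2 * of_real pi * \<i> * w ^ n / fact n)) (circlepath 0 1)"
proof -
  have "((\<lambda>z. exp (w * z) / (z - 0) ^ Suc n) has_contour_integral
      (2 * pi) * \<i> / fact n * (deriv ^^ n) (\<lambda>z. exp (w * z)) 0) (circlepath 0 1)"
    by (rule Cauchy_has_contour_integral_higher_derivative_circlepath)
       (auto intro!: continuous_intros holomorphic_intros)
  then show ?thesis
    by (simp add: higher_deriv_exp_cmult)
qed

text \<open>The singularity is essential: expand only \<open>exp (a / z)\<close> and integrate over the unit circle.\<close>

lemma residue_exp_inverse_exp_over_power: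
  "(\<lambda>j. a ^ j * w ^ (n + j) / (fact j * fact (n + j))) sums
     residue (\<lambda>z. exp (a / z) * exp (w * z) / z ^ Suc n) 0"
proof -
  let ?f = "\<lambda>z. exp (a / z) * exp (w * z) / z ^ Suc n"
  let ?t = "\<lambda>j z. a ^ j / fact j * (exp (w * z) / z ^ Suc (n + j))"
  have bound: "norm (?t j z) \<le> norm a ^ j / fact j * exp (norm w)" if "z \<in> sphere 0 1" for j z
  proof -
    have "norm (exp (w * z)) \<le> exp (norm w)"
      using norm_exp[of "w * z"] that by (simp add: norm_mult)
    then show ?thesis
      using that by (simp add: norm_mult norm_divide norm_power divide_right_mono mult_left_mono)
  qed
  have summ: "summable (\<lambda>j. norm a ^ j / fact j * exp (norm w))"
    using summable_exp[of "norm a"] by (intro summable_mult2) (simp add: divide_inverse mult.commute)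
  have lim: "(\<Sum>j. ?t j z) = ?f z" if "z \<in> sphere 0 1" for z
  proof -
    have "(\<lambda>j. (a / z) ^ j / fact j * (exp (w * z) / z ^ Suc n)) sums (exp (a / z) * (exp (w * z) / z ^ Suc n))"
      using exp_converges[of "a / z"] by (intro sums_mult2) (simp add: scaleR_conv_of_real divide_inverse mult.commute)
    moreover have "(a / z) ^ j / fact j * (exp (w * z) / z ^ Suc n) = ?t j z" for j
      by (simp add: power_divide power_add)
    ultimately show ?thesis
      by (simp add: sums_iff)
  qed
  \<comment> \<open>The M-test on the unit circle permits exchanging the series with the contour
    integral.\<close>
  have "uniform_limit (sphere 0 1) (\<lambda>N z. \<Sum>j<N. ?t j z) (\<lambda>z. \<Sum>j. ?t j z) sequentially"
    by (rule Weierstrass_m_test[OF bound summ])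
  then have ul: "uniform_limit (sphere 0 1) (\<lambda>N z. \<Sum>j<N. ?t j z) ?f sequentially"
    by (subst (asm) uniform_limit_cong'[OF refl lim])
  have int: "((\<lambda>z. \<Sum>j<N. ?t j z) has_contour_integral
      (\<Sum>j<N. a ^ j / fact j * (2 * of_real pi * \<i> * w ^ (n + j) / fact (n + j)))) (circlepath 0 1)" for N
    by (intro has_contour_integral_sum has_contour_integral_lmul contour_integral_exp_over_power) auto
  have "(\<lambda>N. contour_integral (circlepath 0 1) (\<lambda>z. \<Sum>j<N. ?t j z)) \<longlonglongrightarrow> contour_integral (circlepath 0 1) ?f"
    using int has_contour_integral_integrable
    by (intro contour_integral_uniform_limit_circlepath[OF _ ul]) (auto intro!: always_eventually)
  then have "(\<lambda>j. a ^ j / fact j * (2 * of_real pi * \<i> * w ^ (n + j) / fact (n + j))) sums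
      contour_integral (circlepath 0 1) ?f"
    unfolding sums_def contour_integral_unique[OF int] .
  \<comment> \<open>The integrand is holomorphic away from 0, so the unit circle already computes
    the residue.\<close>
  also have "contour_integral (circlepath 0 1) ?f = 2 * pi * \<i> * residue ?f 0"
    by (intro contour_integral_unique base_residue[of UNIV]) (auto intro!: holomorphic_intros)
  finally have "(\<lambda>j. inverse (2 * pi * \<i>) * (a ^ j / fact j * (2 * of_real pi * \<i> * w ^ (n + j) / fact (n + j)))) sums
      (inverse (2 * pi * \<i>) * (2 * pi * \<i> * residue ?f 0))"
    by (rule sums_mult)
  then show ?thesis
    by (simp add: field_simps)
qed

lemma contour_integral_linepath_same_Im:
  assumes "a < b"
  shows "contour_integral (linepath (Complex a c) (Complex b c)) f = integral {a..b} (\<lambda>x. f (Complex x c))"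
proof -
  have "contour_integral (linepath (Complex a c) (Complex b c)) f =
         (Complex b c - Complex a c) * integral {0..1} (\<lambda>x. f (linepath (Complex a c) (Complex b c) x))"
    by (simp add: contour_integral_integral)
  also have "Complex b c - Complex a c = of_real (b - a)"
    by (simp add: complex_eq_iff)
  also have "(\<lambda>x. f (linepath (Complex a c) (Complex b c) x)) = (\<lambda>x. f (Complex (a + (b - a) * x) c))"
    by (intro ext arg_cong[of _ _ f]) (simp add: linepath_def complex_eq_iff algebra_simps)
  also have "integral {0..1} \<dots> = integral {a-a..b-a} (\<lambda>x. f (Complex (x + a) c)) / of_real (b - a)"
  proof -
    have "{0..1} = (\<lambda>x. x / (b - a)) ` {a-a..b - a}"
      using assms by simp
    then show ?thesis
      using assms integral_stretch_real[of "b - a" 0 "b - a" "\<lambda>x. f (Complex (a + x) c)"]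
      by (simp add: scaleR_conv_of_real add_ac divide_simps)
  qed
  also have "integral {a-a..b-a} (\<lambda>x. f (Complex (x + a) c)) = integral {a..b} (\<lambda>x. f (Complex x c))"
    by (subst integral_shift_real_ivl) (rule refl)
  finally show ?thesis
    using assms by simp
qed

text \<open>Close the segment in the lower half plane by the rectangle with the bottom side on $\mathrm{Im}\,z = -N$.\<close>

lemma improper_line_integral_eq_residue:
  fixes f :: "complex \<Rightarrow> complex" and \<theta> C :: real
  assumes holo: "f holomorphic_on - {0}"
    and bound: "\<And>z. 1 \<le> norm z \<Longrightarrow> Im z \<le> 1 \<Longrightarrow> norm (f z) \<le> C / norm z ^ 2"
    and \<theta>: "\<bar>\<theta>\<bar> \<le> 1"
  shows "(\<lambda>N. integral {\<theta> - real N..\<theta> + real N} (\<lambda>x. f (Complex x 1))) \<longlonglongrightarrow> - 2 * of_real pi * \<i> * residue f 0"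
proof -
  define L where "L = - 2 * of_real pi * \<i> * residue f 0"
  have C: "C \<ge> 0"
    using order_trans[OF norm_ge_zero bound[of 1]] by simp
  \<comment> \<open>The constant 24 is 3 * 4 * 2: three sides, each of length at most 2N, on which
    |z| >= N - 1 >= N/2 and hence |f| <= 4C / N^2.\<close>
  have key: "norm (integral {\<theta> - real N..\<theta> + real N} (\<lambda>x. f (Complex x 1)) - L) \<le> C * (24 / real N)"
    if N: "N \<ge> 2" for N
  proof -
    \<comment> \<open>Corners in counterclockwise order from the lower left, so the winding number
      around 0 is 1.\<close>
    define a1 a2 a3 a4 where "a1 = Complex (\<theta> - real N) (- real N)" "a2 = Complex (\<theta> + real N) (- real N)"
      "a3 = Complex (\<theta> + real N) 1" "a4 = Complex (\<theta> - real N) 1"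
    note a_defs = this
    let ?r = "rectpath a1 a3"
    have rp: "?r = linepath a1 a2 +++ linepath a2 a3 +++ linepath a3 a4 +++ linepath a4 a1"
      by (simp add: rectpath_def Let_def a_defs)
    have N2: "real N \<ge> 2"
      using N by simp
    have box: "0 \<in> box a1 a3"
      using \<theta> N2 by (auto simp: a_defs in_box_complex_iff)
    have img: "path_image ?r \<inter> box a1 a3 = {}"
      by (rule path_image_rectpath_inter_box) (use N2 in \<open>auto simp: a_defs\<close>)
    then have "0 \<notin> path_image ?r"
      using box by auto
    moreover have "path_image ?r = closed_segment a1 a2 \<union> closed_segment a2 a3 \<union> closed_segment a3 a4 \<union> closed_segment a4 a1"
      by (simp add: rp path_image_join Un_assoc)
    ultimately have n0: "0 \<notin> closed_segment a1 a2" "0 \<notin> closed_segment a2 a3"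
      "0 \<notin> closed_segment a3 a4" "0 \<notin> closed_segment a4 a1" and p0: "path_image ?r \<subseteq> UNIV - {0}"
      by auto
    have cont: "continuous_on A f" if "0 \<notin> A" for A
      by (rule continuous_on_subset[OF holomorphic_on_imp_continuous_on[OF holo]]) (use that in auto)
    have ci: "f contour_integrable_on linepath a1 a2" "f contour_integrable_on linepath a2 a3"
      "f contour_integrable_on linepath a3 a4" "f contour_integrable_on linepath a4 a1"
      using n0 by (auto intro!: contour_integrable_continuous_linepath cont)
    have "contour_integral ?r f = 2 * pi * \<i> * (\<Sum>p\<in>{0}. winding_number ?r p * residue f p)"
      by (rule Residue_theorem[of UNIV]) (use holo p0 in \<open>auto simp: Compl_eq_Diff_UNIV\<close>)
    also have "\<dots> = - L"
      by (simp add: winding_number_rectpath[OF box] L_def)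
    finally have "contour_integral (linepath a1 a2) f + (contour_integral (linepath a2 a3) f +
      (contour_integral (linepath a3 a4) f + contour_integral (linepath a4 a1) f)) = - L"
      using ci by (simp add: rp)
    \<comment> \<open>The top side is traversed from right to left; this is the source of the minus
      sign in the limit.\<close>
    moreover have "contour_integral (linepath a3 a4) f = - contour_integral (linepath a4 a3) f"
      using contour_integral_reverse_linepath[of a4 a3 f] cont n0 by (simp add: closed_segment_commute)
    moreover have "contour_integral (linepath a4 a3) f = integral {\<theta> - real N..\<theta> + real N} (\<lambda>x. f (Complex x 1))"
      unfolding a_defs by (rule contour_integral_linepath_same_Im) (use N2 in auto)
    ultimately have eq: "integral {\<theta> - real N..\<theta> + real N} (\<lambda>x. f (Complex x 1)) - L =
       contour_integral (linepath a1 a2) f + contour_integral (linepath a2 a3) f + contour_integral (linepath a4 a1) f"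
      by (simp add: algebra_simps)
    have b: "norm (contour_integral (linepath u v) f) \<le> 4 * C / real N ^ 2 * norm (v - u)"
      if "f contour_integrable_on linepath u v" "\<And>z. z \<in> closed_segment u v \<Longrightarrow> real N - 1 \<le> norm z \<and> Im z \<le> 1" for u v
    proof (rule contour_integral_bound_linepath[OF that(1)])
      fix z assume "z \<in> closed_segment u v"
      with that(2) have z: "real N - 1 \<le> norm z" "Im z \<le> 1"
        by auto
      then have "norm (f z) \<le> C / norm z ^ 2"
        using N2 by (intro bound) auto
      also have "\<dots> \<le> C / (real N / 2) ^ 2"
        using C z N2 by (intro divide_left_mono power_mono mult_pos_pos) (auto intro!: zero_less_power)
      finally show "norm (f z) \<le> 4 * C / real N ^ 2"
        by (simp add: power_divide mult.commute)
    qed (use C in auto)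
    have s1: "real N - 1 \<le> norm z \<and> Im z \<le> 1" if "z \<in> closed_segment a1 a2" for z
      using that abs_Im_le_cmod[of z] N2 by (auto simp: closed_segment_same_Im a_defs)
    have s2: "real N - 1 \<le> norm z \<and> Im z \<le> 1" if "z \<in> closed_segment a2 a3" for z
      using that abs_Re_le_cmod[of z] N2 \<theta> by (auto simp: closed_segment_same_Re closed_segment_eq_real_ivl a_defs)
    have s3: "real N - 1 \<le> norm z \<and> Im z \<le> 1" if "z \<in> closed_segment a4 a1" for z
      using that abs_Re_le_cmod[of z] N2 \<theta> by (auto simp: closed_segment_same_Re closed_segment_eq_real_ivl a_defs)
    have l: "norm (a2 - a1) \<le> 2 * real N" "norm (a3 - a2) \<le> 2 * real N" "norm (a1 - a4) \<le> 2 * real N"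
      using cmod_le[of "a2 - a1"] cmod_le[of "a3 - a2"] cmod_le[of "a1 - a4"] N2 by (auto simp: a_defs)
    have "norm (integral {\<theta> - real N..\<theta> + real N} (\<lambda>x. f (Complex x 1)) - L) \<le>
      4 * C / real N ^ 2 * norm (a2 - a1) + 4 * C / real N ^ 2 * norm (a3 - a2) + 4 * C / real N ^ 2 * norm (a1 - a4)"
      unfolding eq using b[OF ci(1) s1] b[OF ci(2) s2] b[OF ci(4) s3]
      by (intro order_trans[OF norm_triangle_ineq] add_mono) auto
    also have "\<dots> \<le> 4 * C / real N ^ 2 * (2 * real N) + 4 * C / real N ^ 2 * (2 * real N) + 4 * C / real N ^ 2 * (2 * real N)"
      using l C by (intro add_mono mult_left_mono) auto
    also have "\<dots> = C * (24 / real N)"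
      by (simp add: power2_eq_square field_simps)
    finally show ?thesis
      by simp
  qed
  have "(\<lambda>N. integral {\<theta> - real N..\<theta> + real N} (\<lambda>x. f (Complex x 1)) - L) \<longlonglongrightarrow> 0"
  proof (rule Lim_null_comparison)
    show "\<forall>\<^sub>F N in sequentially. norm (integral {\<theta> - real N..\<theta> + real N} (\<lambda>x. f (Complex x 1)) - L) \<le> C * (24 / real N)"
      using key by (intro eventually_sequentiallyI)
    show "(\<lambda>N. C * (24 / real N)) \<longlonglongrightarrow> 0"
      by (intro tendsto_mult_right_zero lim_const_over_n)
  qed
  then show ?thesis
    unfolding L_def by (rule LIM_zero_cancel)
qed

section \<open>The integral kernel of a row\<close>

lemma e_add: "e (z + w) = e z * e w"
  by (simp add: e_def ring_distribs exp_add)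

lemma e_of_int: "e (of_int n) = 1"
  using exp_integer_2pi[of "of_int n"] by (simp add: e_def mult_ac)

lemma norm_e: "norm (e z) = exp (- 2 * pi * Im z)"
  by (simp add: e_def)

text \<open>A summand with $c \neq 0$ depends on $z$ only through \<open>kern k (m / c\<^sup>2) (z + d / c)\<close>, up to a
  constant of absolute value $|c|^{-k}$. Summing over $d$ in a residue class modulo $c$ therefore
  unfolds the integral over $[0,1]$ to one over the whole line.\<close>

definition kern :: "nat \<Rightarrow> real \<Rightarrow> complex \<Rightarrow> complex" where
  "kern k \<mu> z = e (- (of_real \<mu> / z)) * e (- z) / z ^ k"

text \<open>The value of the integral of \<open>kern k \<mu>\<close> over the line Im z = 1, denoted
  A in the introduction. For positive \<mu> it is the classical 2 pi i^(-k) \<mu>^((1-k)/2)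
  J_{k-1}(4 pi sqrt \<mu>); the form with \<open>bessel_F\<close> avoids the square root.\<close>

definition kern_lim :: "nat \<Rightarrow> real \<Rightarrow> complex" where
  "kern_lim k \<mu> = (- 2 * of_real pi * \<i>) ^ k * of_real (bessel_F (k - 1) (4 * pi\<^sup>2 * \<mu>))"

lemma kern_Suc:
  "kern (Suc n) \<mu> = (\<lambda>z. exp ((- 2 * of_real pi * \<i> * of_real \<mu>) / z) * exp (- 2 * of_real pi * \<i> * z) / z ^ Suc n)"
  by (simp add: kern_def e_def fun_eq_iff)

text \<open>With a = -2 pi i \<mu> and w = -2 pi i the product a w is the real number -4 pi^2 \<mu>.
  Hence the residue is w^n times a real Bessel series, and the prefactor -2 pi i completes the power
  w^(n+1).\<close>

lemma residue_kern:
  "- 2 * of_real pi * \<i> * residue (kern (Suc n) \<mu>) 0 = kern_lim (Suc n) \<mu>"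
proof -
  let ?w = "- 2 * of_real pi * \<i> :: complex"
  have aw: "?w * of_real \<mu> * ?w = of_real (- (4 * pi\<^sup>2 * \<mu>))"
    by (simp add: power2_eq_square)
  have "(?w * of_real \<mu>) ^ j * ?w ^ (n + j) / (fact j * fact (n + j)) =
      ?w ^ n * of_real (bessel_coeff n j * (4 * pi\<^sup>2 * \<mu>) ^ j)" for j
  proof -
    have "x ^ j * y ^ (n + j) = y ^ n * (x * y) ^ j" for x y :: complex
      by (simp add: power_mult_distrib power_add)
    then have "(?w * of_real \<mu>) ^ j * ?w ^ (n + j) = ?w ^ n * (?w * of_real \<mu> * ?w) ^ j" .
    also have "?w ^ n * (?w * of_real \<mu> * ?w) ^ j = ?w ^ n * of_real ((- 1) ^ j * (4 * pi\<^sup>2 * \<mu>) ^ j)"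
      by (simp only: aw flip: of_real_power power_mult_distrib) simp
    finally show ?thesis
      by (simp add: bessel_coeff_def)
  qed
  moreover have "(\<lambda>j. ?w ^ n * of_real (bessel_coeff n j * (4 * pi\<^sup>2 * \<mu>) ^ j)) sums
      (?w ^ n * of_real (bessel_F n (4 * pi\<^sup>2 * \<mu>)))"
    unfolding bessel_F_def by (intro sums_mult sums_of_real summable_sums summable_bessel_F)
  ultimately have "residue (kern (Suc n) \<mu>) 0 = ?w ^ n * of_real (bessel_F n (4 * pi\<^sup>2 * \<mu>))"
    using residue_exp_inverse_exp_over_power[of "?w * of_real \<mu>" ?w n] sums_unique2
    unfolding kern_Suc by (simp only:) blast
  then show ?thesis
    by (simp add: kern_lim_def)
qed

text \<open>For |z| >= 1 and Im z <= 1 both exponential factors are bounded: |\<mu> / z| is at most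
  \<mu>, and e(-z) is small in the lower half plane. The power z^k supplies the quadratic decay. The
  offset \<theta> will be r / c for a residue r modulo c.\<close>

lemma tendsto_integral_kern:
  assumes k: "2 \<le> k" and \<mu>: "0 \<le> \<mu>" and \<theta>: "\<bar>\<theta>\<bar> \<le> 1"
  shows "(\<lambda>N. integral {\<theta> - real N..\<theta> + real N} (\<lambda>x. kern k \<mu> (Complex x 1))) \<longlonglongrightarrow> kern_lim k \<mu>"
proof -
  obtain n where n: "k = Suc n" "1 \<le> n"
    using k by (cases k) auto
  have "kern k \<mu> holomorphic_on - {0}"
    unfolding n kern_Suc by (auto intro!: holomorphic_intros)
  moreover have "norm (kern k \<mu> z) \<le> exp (2 * pi * \<mu> + 2 * pi) / norm z ^ 2"
    if z: "1 \<le> norm z" "Im z \<le> 1" for z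
  proof -
    have "Im (of_real \<mu> / z) \<le> norm (of_real \<mu> / z)"
      using abs_Im_le_cmod[of "of_real \<mu> / z"] by linarith
    also have "\<dots> \<le> \<mu>"
      using z(1) \<mu> mult_left_mono[OF z(1) \<mu>] by (simp add: norm_divide divide_simps)
    finally have "norm (e (- (of_real \<mu> / z))) \<le> exp (2 * pi * \<mu>)"
      by (simp add: norm_e)
    moreover have "norm (e (- z)) \<le> exp (2 * pi)"
      using z by (simp add: norm_e)
    moreover have "norm z ^ 2 \<le> norm z ^ k"
      using z k by (intro power_increasing) auto
    ultimately have "norm (e (- (of_real \<mu> / z))) * norm (e (- z)) / norm z ^ k \<le>
        exp (2 * pi * \<mu>) * exp (2 * pi) / norm z ^ 2"
      using z by (intro frac_le mult_mono) auto
    then show ?thesis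
      by (simp add: kern_def norm_mult norm_divide norm_power exp_add)
  qed
  ultimately have "(\<lambda>N. integral {\<theta> - real N..\<theta> + real N} (\<lambda>x. kern k \<mu> (Complex x 1))) \<longlonglongrightarrow>
      - 2 * of_real pi * \<i> * residue (kern k \<mu>) 0"
    using \<theta> by (rule improper_line_integral_eq_residue)
  then show ?thesis
    by (simp only: n residue_kern)
qed

lemma norm_kern_lim_le:
  assumes "0 \<le> \<mu>"
  shows "norm (kern_lim (Suc n) \<mu>) \<le> (2 * pi) ^ Suc n * exp (4 * pi\<^sup>2 * \<mu> / (real n + 1)) / fact n"
  using abs_bessel_F_le[of n "4 * pi\<^sup>2 * \<mu>"] assms
  by (simp add: kern_lim_def norm_mult norm_power abs_mult mult_left_mono divide_inverse mult.assoc)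

lemma norm_kern_lim_ge:
  assumes "0 \<le> \<mu>" "4 * (4 * pi\<^sup>2 * \<mu>) \<le> (real n + 1) * (real n + 2)"
  shows "(2 * pi) ^ Suc n * exp (- 2 * (4 * pi\<^sup>2 * \<mu>) / (real n + 1)) / fact n \<le> norm (kern_lim (Suc n) \<mu>)"
  using order_trans[OF bessel_F_ge[of "4 * pi\<^sup>2 * \<mu>" n] abs_ge_self] assms
  by (simp add: kern_lim_def norm_mult norm_power abs_mult mult_left_mono divide_inverse mult.assoc)

text \<open>Bezout guarantees that the choice in \<open>upper_row\<close> has a witness. The
  determinant identity is the only property of the chosen row used below.\<close>

lemma coprime_upper_row:
  assumes "coprime c d"
  shows "fst (upper_row c d) * d - snd (upper_row c d) * c = 1"
proof -
  obtain u v where "u * c + v * d = 1"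
    using assms by (metis bezout_int coprime_iff_gcd_eq_1)
  then have "\<exists>p. case p of (a, b) \<Rightarrow> a * d - b * c = 1"
    by (intro exI[of _ "(v, - u)"]) (simp add: algebra_simps)
  then have "case upper_row c d of (a, b) \<Rightarrow> a * d - b * c = 1"
    unfolding upper_row_def by (rule someI_ex)
  then show ?thesis
    by (simp add: case_prod_beta)
qed

lemma of_int_mult_add_neq_0:
  fixes z :: complex
  assumes "0 < Im z" "(c, d) \<noteq> (0, 0)"
  shows "of_int c * z + of_int d \<noteq> 0"
  using assms by (auto simp: complex_eq_iff)

definition poincare_term :: "nat \<Rightarrow> int \<Rightarrow> int \<times> int \<Rightarrow> complex \<Rightarrow> complex" where
  "poincare_term k m = (\<lambda>(c, d) z. inverse ((of_int c * z + of_int d) ^ k) *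
     e (of_int m * moeb (fst (upper_row c d)) (snd (upper_row c d)) c d z))"

text \<open>With y = z + d/c one has cz + d = cy and, by the determinant identity, (az+b)/(cz+d) =
  a/c - 1/(c^2 y). The factor e(-z) splits as e(d/c) e(-y).\<close>

lemma poincare_term_eq_kern:
  assumes cd: "coprime c d" and c: "c \<noteq> 0" and z: "0 < Im z"
  shows "poincare_term k m (c, d) z * e (- z) =
    e (of_int (m * fst (upper_row c d)) / of_int c) * e (of_int d / of_int c) / of_int c ^ k *
    kern k (of_int m / of_int c ^ 2) (z + of_int d / of_int c)"
proof -
  obtain a b where ab: "upper_row c d = (a, b)"
    by fastforce
  have det: "of_int a * of_int d - of_int b * of_int c = (1::complex)"
    using coprime_upper_row[OF cd] by (simp add: ab flip: of_int_mult of_int_diff)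
  define y where "y = z + of_int d / of_int c"
  have y: "of_int c * z + of_int d = of_int c * y"
    using c by (simp add: y_def field_simps)
  have y0: "y \<noteq> 0"
    using of_int_mult_add_neq_0[OF z, of c d] c unfolding y by auto
  have "of_int c * (of_int a * z + of_int b) = of_int a * (of_int c * y) - 1"
    unfolding y[symmetric] using det by (simp add: algebra_simps)
  then have X: "of_int a * z + of_int b = (of_int a * (of_int c * y) - 1) / of_int c"
    using c by (simp add: field_simps)
  have mo: "moeb a b c d z = of_int a / of_int c - 1 / (of_int c ^ 2 * y)"
    using c y0 unfolding moeb_def y X by (simp add: field_simps power2_eq_square)
  have "of_int m * moeb a b c d z = of_int (m * a) / of_int c + - (of_real (of_int m / of_int c ^ 2) / y)"
    unfolding mo by (simp add: right_diff_distrib)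
  then have 1: "e (of_int m * moeb a b c d z) = e (of_int (m * a) / of_int c) * e (- (of_real (of_int m / of_int c ^ 2) / y))"
    by (simp only: e_add)
  have "- z = of_int d / of_int c + - y"
    by (simp add: y_def)
  then have 2: "e (- z) = e (of_int d / of_int c) * e (- y)"
    by (simp only: e_add)
  show ?thesis
    unfolding poincare_term_def kern_def case_prod_conv ab fst_conv snd_conv 1 2 y y_def[symmetric]
    by (simp add: power_mult_distrib field_simps)
qed

section \<open>Termwise integration of the Poincare series\<close>

lemma summable_on_int_inverse_square: "(\<lambda>c::int. 1 / (1 + of_int c ^ 2) :: real) summable_on UNIV"
proof -
  have "summable (\<lambda>n. 1 / (1 + real n ^ 2))"
  proof (rule summable_comparison_test)
    show "summable (\<lambda>n. inverse (real n ^ 2))"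
      by (rule inverse_power_summable) simp
    show "\<exists>N. \<forall>n\<ge>N. norm (1 / (1 + real n ^ 2)) \<le> inverse (real n ^ 2)"
    proof (intro exI[of _ 1] allI impI)
      fix n :: nat assume "1 \<le> n"
      then have "1 / (1 + real n ^ 2) \<le> 1 / real n ^ 2"
        by (intro frac_le) auto
      then show "norm (1 / (1 + real n ^ 2)) \<le> inverse (real n ^ 2)"
        by (simp add: inverse_eq_divide)
    qed
  qed
  then have nat: "(\<lambda>n. 1 / (1 + real n ^ 2)) summable_on UNIV"
    by (rule summable_nonneg_imp_summable_on) simp
  have "(\<lambda>c::int. 1 / (1 + of_int c ^ 2) :: real) summable_on range int \<union> range (\<lambda>n. - int n)"
    using nat by (intro summable_on_union) (auto simp: summable_on_reindex inj_def o_def)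
  also have "range int \<union> range (\<lambda>n. - int n) = UNIV"
  proof -
    have "c \<in> range int \<union> range (\<lambda>n. - int n)" for c
      by (cases c rule: int_cases2) auto
    then show ?thesis
      by blast
  qed
  finally show ?thesis .
qed

lemma summable_on_int_pairs:
  "(\<lambda>(c::int, d::int). 1 / ((1 + of_int c ^ 2) * (1 + of_int d ^ 2)) :: real) summable_on UNIV"
proof -
  let ?g = "\<lambda>c::int. 1 / (1 + of_int c ^ 2) :: real"
  have "(\<lambda>(c::int, d::int). ?g c * ?g d) summable_on (UNIV \<times> UNIV)"
  proof (rule summable_on_SigmaI)
    show "((\<lambda>d. case (c, d) of (c, d) \<Rightarrow> ?g c * ?g d) has_sum ?g c * infsum ?g UNIV) UNIV" for c
      using summable_on_int_inverse_square by (simp only: case_prod_conv) (intro has_sum_cmult_right has_sum_infsum)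
    show "(\<lambda>c. ?g c * infsum ?g UNIV) summable_on UNIV"
      using summable_on_int_inverse_square by (intro summable_on_cmult_left)
  qed simp
  then show ?thesis
    by simp
qed

text \<open>On Im z = 1 put y = cz + d. The image point lies in the closed upper half plane, so the
  exponential is at most 1. Both 1 + c^2 and 1 + d^2 are at most 6 |y|^2, so their product is at
  most 36 |y|^4, and k >= 4 with |y| >= 1 finishes. The factor exp(2 pi) is the norm of
  e(-z).\<close>

lemma norm_poincare_term_le:
  assumes k: "4 \<le> k" and m: "0 \<le> m" and cd: "coprime c d" and x: "x \<in> {0..1}"
  shows "norm (poincare_term k m (c, d) (of_real x + \<i>) * e (- (of_real x + \<i>))) \<le>
    36 * exp (2 * pi) * (1 / ((1 + of_int c ^ 2) * (1 + of_int d ^ 2)))"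
proof -
  define z where "z = of_real x + \<i>"
  define y where "y = of_int c * z + of_int d"
  obtain a b where ab: "upper_row c d = (a, b)"
    by fastforce
  have det: "of_int a * of_int d - of_int b * of_int c = (1::real)"
    using coprime_upper_row[OF cd] by (simp add: ab flip: of_int_mult of_int_diff)
  have cd0: "(c, d) \<noteq> (0, 0)"
    using cd by auto
  have ny: "norm y ^ 2 = (of_int c * x + of_int d) ^ 2 + of_int c ^ 2"
    by (simp add: y_def z_def cmod_power2)
  have "Im ((of_int a * z + of_int b) * cnj y) = of_int a * of_int d - of_int b * of_int c"
    by (simp add: y_def z_def algebra_simps)
  then have "0 \<le> Im (moeb a b c d z)"
    unfolding moeb_def y_def[symmetric] Im_complex_div_ge_0 by (simp add: det)
  then have e1: "norm (e (of_int m * moeb a b c d z)) \<le> 1"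
    using m by (simp add: norm_e)
  have e2: "norm (e (- z)) = exp (2 * pi)"
    by (simp add: norm_e z_def)
  have "1 \<le> norm y ^ 2"
  proof (cases "c = 0")
    case True
    with cd have "d = 1 \<or> d = - 1"
      by auto
    then show ?thesis
      by (elim disjE) (simp_all add: ny True)
  next
    case False
    then have "1 \<le> \<bar>real_of_int c\<bar>"
      by linarith
    then have "1 \<le> real_of_int c ^ 2"
      using power_mono[of 1 "\<bar>real_of_int c\<bar>" 2] by simp
    then show ?thesis
      by (simp add: ny add_increasing)
  qed
  then have y1: "1 \<le> norm y"
    using power2_le_imp_le[of 1 "norm y"] by simp
  \<comment> \<open>Write d as (cx + d) - cx and use (u - v)^2 <= 2u^2 + 2v^2.\<close>
  have "real_of_int d ^ 2 \<le> 2 * (of_int c * x + of_int d) ^ 2 + 2 * (of_int c * x) ^ 2"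
  proof -
    have "(u + v - u) ^ 2 \<le> 2 * (u + v) ^ 2 + 2 * u ^ 2" for u v :: real
      using zero_le_power2[of "(u + v) + u"] by (simp add: power2_eq_square algebra_simps)
    then show ?thesis
      by (metis add_diff_cancel_left')
  qed
  moreover have "(of_int c * x) ^ 2 \<le> real_of_int c ^ 2"
    using x mult_left_mono[of "x\<^sup>2" 1 "real_of_int c ^ 2"] by (simp add: power_mult_distrib power_le_one)
  moreover have arith: "D \<le> 2 * A + 2 * B \<Longrightarrow> B \<le> C \<Longrightarrow> 0 \<le> A \<Longrightarrow> C + D \<le> 3 * (A + C)" for A B C D :: real
    by (simp add: algebra_simps)
  ultimately have "real_of_int c ^ 2 + real_of_int d ^ 2 \<le> 3 * norm y ^ 2"
    unfolding ny by (intro arith) auto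
  with \<open>1 \<le> norm y ^ 2\<close> have b: "1 + real_of_int c ^ 2 \<le> 6 * norm y ^ 2" "1 + real_of_int d ^ 2 \<le> 6 * norm y ^ 2"
    using zero_le_power2[of "real_of_int c"] zero_le_power2[of "real_of_int d"] by linarith+
  have "(1 + real_of_int c ^ 2) * (1 + real_of_int d ^ 2) \<le> (6 * norm y ^ 2) * (6 * norm y ^ 2)"
    using b by (intro mult_mono) auto
  also have "\<dots> = 36 * norm y ^ 4"
    by (simp add: power2_eq_square power4_eq_xxxx)
  also have "\<dots> \<le> 36 * norm y ^ k"
    using y1 k by (intro mult_left_mono power_increasing) auto
  finally have P: "(1 + real_of_int c ^ 2) * (1 + real_of_int d ^ 2) \<le> 36 * norm y ^ k" .
  have "inverse Y \<le> 36 * (1 / Q)" if "Q \<le> 36 * Y" "0 < Q" "0 < Y" for Q Y :: real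
    using that by (simp add: field_simps)
  moreover have "0 < (1 + real_of_int c ^ 2) * (1 + real_of_int d ^ 2)"
    by (intro mult_pos_pos add_pos_nonneg) auto
  moreover have "0 < norm y ^ k"
    using y1 by (intro zero_less_power) linarith
  ultimately have "inverse (norm y ^ k) \<le> 36 * (1 / ((1 + of_int c ^ 2) * (1 + of_int d ^ 2)))"
    using P by blast
  then have "inverse (norm y ^ k) * norm (e (of_int m * moeb a b c d z)) \<le>
      36 * (1 / ((1 + of_int c ^ 2) * (1 + of_int d ^ 2)))"
    using e1 by (intro order_trans[OF mult_left_le]) auto
  from mult_right_mono[OF this, of "exp (2 * pi)"] show ?thesis
    unfolding z_def[symmetric] poincare_term_def
    by (simp add: ab norm_mult norm_inverse norm_power e2 y_def[symmetric])
qed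

definition term_integral :: "nat \<Rightarrow> int \<Rightarrow> int \<times> int \<Rightarrow> complex" where
  "term_integral k m p = integral {0..1} (\<lambda>x::real. poincare_term k m p (of_real x + \<i>) * e (- (of_real x + \<i>)))"

lemma continuous_on_poincare_term:
  "continuous_on {0..1} (\<lambda>x::real. poincare_term k m p (of_real x + \<i>) * e (- (of_real x + \<i>)))"
proof -
  obtain c d where p: "p = (c, d)"
    by fastforce
  show ?thesis
  proof (cases "p = (0, 0)")
    \<comment> \<open>The row (0,0) is no bottom row, but covering it allows sums over arbitrary
      index sets later. Division by zero yields 0 here, so only e(-z) varies with x.\<close>
    case True
    then show ?thesis
      by (auto simp: poincare_term_def moeb_def e_def intro!: continuous_intros)
  next
    case False
    then have "of_int c * (of_real x + \<i>) + of_int d \<noteq> 0" for x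
      using of_int_mult_add_neq_0[of "of_real x + \<i>" c d] p by simp
    then show ?thesis
      by (auto simp: p poincare_term_def moeb_def e_def intro!: continuous_intros)
  qed
qed

text \<open>The majorant over all integer pairs gives uniform convergence along finite sets of rows,
  so integration over [0,1] may be carried out row by row.\<close>

lemma has_sum_term_integral:
  assumes k: "4 \<le> k" and m: "0 \<le> m"
  shows "(term_integral k m has_sum fourier_coeff (poincare k m N) 1) (bottom_rows N)"
proof -
  let ?f = "\<lambda>p (x::real). poincare_term k m p (of_real x + \<i>) * e (- (of_real x + \<i>))"
  let ?M = "\<lambda>(c, d). 36 * exp (2 * pi) * (1 / ((1 + real_of_int c ^ 2) * (1 + real_of_int d ^ 2)))"
  have "?M summable_on UNIV"
    using summable_on_cmult_right[OF summable_on_int_pairs, of "36 * exp (2 * pi)"] by (simp add: case_prod_unfold)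
  then have M: "?M summable_on bottom_rows N"
    by (rule summable_on_subset_banach) simp
  have lim: "uniform_limit {0..1} (\<lambda>Y x. \<Sum>p\<in>Y. ?f p x) (\<lambda>x. \<Sum>\<^sub>\<infinity>p\<in>bottom_rows N. ?f p x) (finite_subsets_at_top (bottom_rows N))"
    using norm_poincare_term_le[OF k m]
    by (intro Weierstrass_m_test_general[OF _ M]) (auto simp: bottom_rows_def)
  have cont: "continuous_on {0..1} (\<lambda>x. \<Sum>p\<in>Y. ?f p x)" for Y
    by (intro continuous_on_sum continuous_on_poincare_term)
  obtain I J where I: "\<And>Y. ((\<lambda>x. \<Sum>p\<in>Y. ?f p x) has_integral I Y) {0..1}"
    and J: "((\<lambda>x. \<Sum>\<^sub>\<infinity>p\<in>bottom_rows N. ?f p x) has_integral J) {0..1}"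
    and IJ: "(I \<longlongrightarrow> J) (finite_subsets_at_top (bottom_rows N))"
    by (rule uniform_limit_integral[OF lim cont finite_subsets_at_top_neq_bot]) (erule (2) that)
  have "I Y = (\<Sum>p\<in>Y. term_integral k m p)" if "finite Y" for Y
  proof -
    have "((\<lambda>x. \<Sum>p\<in>Y. ?f p x) has_integral (\<Sum>p\<in>Y. term_integral k m p)) {0..1}"
      unfolding term_integral_def using that
      by (intro has_integral_sum integrable_integral integrable_continuous_real continuous_on_poincare_term)
    then show ?thesis
      by (rule has_integral_unique[OF I])
  qed
  \<comment> \<open>The integrals I Y are identified with sums of row integrals for finite Y, which
    is all that the filter sees.\<close>
  then have "\<forall>\<^sub>F Y in finite_subsets_at_top (bottom_rows N). I Y = (\<Sum>p\<in>Y. term_integral k m p)"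
    by (intro eventually_finite_subsets_at_top_weakI) auto
  then have "(term_integral k m has_sum J) (bottom_rows N)"
    unfolding has_sum_def using IJ by (rule Lim_transform_eventually[rotated])
  moreover have "fourier_coeff (poincare k m N) 1 = J"
  proof -
    have "(\<Sum>\<^sub>\<infinity>p\<in>bottom_rows N. ?f p x) = poincare k m N (of_real x + \<i>) * e (- (of_real x + \<i>))" for x
      by (simp add: infsum_cmult_left' poincare_def poincare_term_def case_prod_unfold)
    then show ?thesis
      using J by (simp add: fourier_coeff_def integral_unique)
  qed
  ultimately show ?thesis
    by simp
qed

section \<open>Summation over the integers and tiling of the real line\<close>

lemma infsum_int_tendsto:
  fixes f :: "int \<Rightarrow> complex"
  assumes "f summable_on UNIV"
  shows "(\<lambda>N. \<Sum>q\<in>{- int N..<int N}. f q) \<longlonglongrightarrow> infsum f UNIV"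
proof -
  have "filterlim (\<lambda>N. {- int N..<int N}) (finite_subsets_at_top UNIV) sequentially"
    unfolding filterlim_finite_subsets_at_top
  proof (intro allI impI)
    fix X :: "int set" assume "finite X \<and> X \<subseteq> UNIV"
    then obtain B where B: "\<And>x. x \<in> X \<Longrightarrow> \<bar>x\<bar> \<le> B"
      by (metis finite_nat_iff_bounded_le finite_imageI abs_le_D1 bdd_above_finite bdd_above.E imageI)
    then have "X \<subseteq> {- int N..<int N}" if "N \<ge> nat B + 1" for N
      using that B by fastforce
    then show "\<forall>\<^sub>F N in sequentially. finite {- int N..<int N} \<and> X \<subseteq> {- int N..<int N} \<and> {- int N..<int N} \<subseteq> UNIV"
      by (intro eventually_sequentiallyI[of "nat B + 1"]) auto
  qed
  with has_sum_infsum[OF assms] show ?thesis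
    unfolding has_sum_def by (rule filterlim_compose)
qed

text \<open>The blocks q = -N, ..., N-1 tile an interval symmetric about \<theta>, hence the
  half-open index range. The induction adds one block at each end.\<close>

lemma sum_unit_integrals:
  fixes g :: "real \<Rightarrow> complex"
  assumes "continuous_on UNIV g"
  shows "(\<Sum>q\<in>{- int N..<int N}. integral {\<theta> + of_int q..\<theta> + of_int q + 1} g) = integral {\<theta> - real N..\<theta> + real N} g"
proof (induction N)
  case (Suc N)
  have int: "g integrable_on {a..b}" for a b
    using assms by (intro integrable_continuous_real continuous_on_subset[OF assms]) auto
  have "{- int (Suc N)..<int (Suc N)} = insert (- int N - 1) (insert (int N) {- int N..<int N})"
    by auto
  then have "(\<Sum>q\<in>{- int (Suc N)..<int (Suc N)}. integral {\<theta> + of_int q..\<theta> + of_int q + 1} g) =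
      integral {\<theta> + of_int (- int N - 1)..\<theta> + of_int (- int N - 1) + 1} g +
      (integral {\<theta> + real N..\<theta> + real N + 1} g + (\<Sum>q\<in>{- int N..<int N}. integral {\<theta> + of_int q..\<theta> + of_int q + 1} g))"
    by simp
  also have "\<dots> = integral {\<theta> - real N - 1..\<theta> - real N} g + (integral {\<theta> + real N..\<theta> + real N + 1} g + integral {\<theta> - real N..\<theta> + real N} g)"
    by (simp add: Suc.IH diff_add_eq_diff_diff_swap add_diff_eq)
  also have "\<dots> = integral {\<theta> - real N - 1..\<theta> + real N + 1} g"
    using Henstock_Kurzweil_Integration.integral_combine[OF _ _ int, of "\<theta> - real N - 1" "\<theta> - real N" "\<theta> + real N + 1"]
      Henstock_Kurzweil_Integration.integral_combine[OF _ _ int, of "\<theta> - real N" "\<theta> + real N" "\<theta> + real N + 1"]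
    by (simp add: add.commute)
  finally show ?case
    by (simp add: algebra_simps)
qed simp

section \<open>The contribution of a fixed lower left entry\<close>

lemma e_cong:
  assumes "c \<noteq> 0" "c dvd u - v"
  shows "e (of_int u / of_int c) = e (of_int v / of_int c)"
proof -
  obtain s where "u = v + c * s"
    using assms(2) by (metis add.commute diff_add_cancel dvdE)
  then have "of_int u / of_int c = (of_int v / of_int c + of_int s :: complex)"
    using assms(1) by (simp add: field_simps)
  then show ?thesis
    by (simp only: e_add e_of_int mult_1_right)
qed

lemma norm_e_of_int_div: "norm (e (of_int u / of_int c)) = 1"
proof -
  have "of_int u / of_int c = complex_of_real (of_int u / of_int c)"
    by simp
  then show ?thesis
    unfolding norm_e by (simp only: Im_complex_of_real) simp
qed

text \<open>Modulo c the upper left entry is an inverse of the lower right one, hence determined by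
  its residue class.\<close>

lemma upper_row_cong:
  assumes d: "coprime c d" and r: "coprime c r" and dvd: "c dvd d - r"
  shows "c dvd fst (upper_row c d) - fst (upper_row c r)"
proof -
  obtain a b a' b' where ab: "upper_row c d = (a, b)" "upper_row c r = (a', b')"
    by fastforce
  have "a * d - b * c = 1" "a' * r - b' * c = 1"
    using coprime_upper_row[OF d] coprime_upper_row[OF r] by (simp_all add: ab)
  then have "(a - a') * d = c * (b - b') - a' * (d - r)"
    by (simp add: algebra_simps)
  also have "c dvd \<dots>"
    using dvd by simp
  finally have "c dvd a - a'"
    using d by (simp add: coprime_dvd_mult_left_iff)
  then show ?thesis
    by (simp add: ab)
qed

text \<open>The summand e((m a + d) / c) of the Kloosterman sum S(m,1;c), where a is an inverse of d
  modulo c.\<close>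

definition phase :: "int \<Rightarrow> int \<Rightarrow> int \<Rightarrow> complex" where
  "phase m c d = e (of_int (m * fst (upper_row c d)) / of_int c) * e (of_int d / of_int c)"

lemma phase_cong:
  assumes "c \<noteq> 0" "coprime c d" "coprime c r" "c dvd d - r"
  shows "phase m c d = phase m c r"
proof -
  have "c dvd m * fst (upper_row c d) - m * fst (upper_row c r)"
    using upper_row_cong[OF assms(2-4)] by (metis dvd_mult right_diff_distrib)
  then show ?thesis
    unfolding phase_def by (simp only: e_cong[OF assms(1)] e_cong[OF assms(1,4)])
qed

lemma norm_phase: "norm (phase m c d) = 1"
  by (simp only: phase_def norm_mult norm_e_of_int_div)

lemma term_integral_eq:
  assumes cd: "coprime c d" and c: "c \<noteq> 0"
  shows "term_integral k m (c, d) = phase m c d / of_int c ^ k *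
    integral {of_int d / of_int c..of_int d / of_int c + 1} (\<lambda>x. kern k (of_int m / of_int c ^ 2) (Complex x 1))"
proof -
  let ?t = "real_of_int d / of_int c"
  let ?g = "\<lambda>x. kern k (of_int m / of_int c ^ 2) (Complex x 1)"
  have "poincare_term k m (c, d) (of_real x + \<i>) * e (- (of_real x + \<i>)) =
      phase m c d / of_int c ^ k * ?g (x + ?t)" for x
  proof -
    have "of_real x + \<i> + of_int d / of_int c = Complex (x + ?t) 1"
      by (simp add: Complex_eq)
    then show ?thesis
      using poincare_term_eq_kern[OF cd c, of "of_real x + \<i>" k m] by (simp add: phase_def)
  qed
  then have "term_integral k m (c, d) = phase m c d / of_int c ^ k * integral {?t - ?t..?t + 1 - ?t} (\<lambda>x. ?g (x + ?t))"
    by (simp add: term_integral_def)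
  also have "integral {?t - ?t..?t + 1 - ?t} (\<lambda>x. ?g (x + ?t)) = integral {?t..?t + 1} ?g"
    by (rule integral_shift_real_ivl)
  finally show ?thesis .
qed

definition row_sum :: "nat \<Rightarrow> int \<Rightarrow> int \<Rightarrow> complex" where
  "row_sum k m c = (\<Sum>\<^sub>\<infinity>d\<in>{d. coprime c d}. term_integral k m (c, d))"

text \<open>The rows d = r + cq share one phase, and their unit intervals, starting at r/c + q, tile
  the whole line. The sum therefore unfolds to the full line integral of the kernel.\<close>

lemma infsum_residue_class:
  assumes k: "2 \<le> k" and m: "0 \<le> m" and c: "c \<noteq> 0" and r: "coprime c r" "0 \<le> r" "r < \<bar>c\<bar>"
    and summ: "(\<lambda>q. term_integral k m (c, r + c * q)) summable_on UNIV"
  shows "(\<Sum>\<^sub>\<infinity>q. term_integral k m (c, r + c * q)) = phase m c r / of_int c ^ k * kern_lim k (of_int m / of_int c ^ 2)"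
proof -
  let ?t = "real_of_int r / of_int c"
  let ?g = "\<lambda>x. kern k (of_int m / of_int c ^ 2) (Complex x 1)"
  have "term_integral k m (c, r + c * q) = phase m c r / of_int c ^ k * integral {?t + of_int q..?t + of_int q + 1} ?g" for q
  proof -
    have co: "coprime c (r + c * q)"
      using r(1) by (metis coprime_iff_gcd_eq_1 gcd_add_mult mult.commute add.commute)
    moreover have "phase m c (r + c * q) = phase m c r"
      using c co r(1) by (intro phase_cong) auto
    moreover have "real_of_int (r + c * q) / of_int c = ?t + of_int q"
      using c by (simp add: field_simps)
    ultimately show ?thesis
      by (simp only: term_integral_eq[OF _ c])
  qed
  moreover have "continuous_on UNIV ?g"
  proof -
    have "?g = (\<lambda>x. kern k (of_int m / of_int c ^ 2) (of_real x + \<i>))"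
      by (simp add: Complex_eq)
    moreover have "of_real x + \<i> \<noteq> 0" for x
      by (simp add: complex_eq_iff)
    then have "continuous_on UNIV (\<lambda>x. kern k (of_int m / of_int c ^ 2) (of_real x + \<i>))"
      unfolding kern_def e_def by (intro continuous_intros) auto
    ultimately show ?thesis
      by (simp only:)
  qed
  ultimately have "(\<Sum>q\<in>{- int N..<int N}. term_integral k m (c, r + c * q)) =
      phase m c r / of_int c ^ k * integral {?t - real N..?t + real N} ?g" for N
    using sum_unit_integrals[where g = ?g and \<theta> = ?t and N = N] by (simp only: flip: sum_distrib_left)
  moreover have "(\<lambda>N. phase m c r / of_int c ^ k * integral {?t - real N..?t + real N} ?g) \<longlonglongrightarrow>
      phase m c r / of_int c ^ k * kern_lim k (of_int m / of_int c ^ 2)"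
    using k m r by (intro tendsto_mult_left tendsto_integral_kern) (auto simp: abs_le_iff divide_simps)
  ultimately show ?thesis
    using LIMSEQ_unique infsum_int_tendsto[OF summ] by (simp only:) blast
qed

lemma bottom_rows_1: "bottom_rows 1 = Sigma UNIV (\<lambda>c. {d. coprime c d})"
  by (auto simp: bottom_rows_def)

lemma term_integral_summable:
  assumes "4 \<le> k" "0 \<le> m"
  shows "term_integral k m summable_on Sigma UNIV (\<lambda>c. {d. coprime c d})"
  using has_sum_term_integral[OF assms, of 1] bottom_rows_1 by (metis has_sum_imp_summable)

lemma residue_mod_abs:
  fixes c r q :: int
  assumes "0 \<le> r" "r < \<bar>c\<bar>"
  shows "(r + c * q) mod \<bar>c\<bar> = r"
proof -
  have "(r + \<bar>c\<bar> * (sgn c * q)) mod \<bar>c\<bar> = r"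
    using assms by simp
  then show ?thesis
    by (simp add: abs_mult_sgn flip: mult.assoc)
qed

text \<open>Writing d = r + cq with 0 <= r < |c| reduces the row to finitely many residue classes.
  Each contributes the same line integral times its phase, so a Kloosterman sum appears.\<close>

lemma row_sum_eq:
  assumes k: "4 \<le> k" and m: "0 \<le> m" and c: "c \<noteq> 0"
  shows "row_sum k m c =
    (\<Sum>r | 0 \<le> r \<and> r < \<bar>c\<bar> \<and> coprime c r. phase m c r) / of_int c ^ k * kern_lim k (of_int m / of_int c ^ 2)"
proof -
  define R where "R = {r. 0 \<le> r \<and> r < \<bar>c\<bar> \<and> coprime c r}"
  have "finite R"
    by (rule finite_subset[of _ "{0..<\<bar>c\<bar>}"]) (auto simp: R_def)
  have row: "(\<lambda>d. term_integral k m (c, d)) summable_on {d. coprime c d}"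
    using term_integral_summable[OF k m] summable_on_SigmaD1[of "\<lambda>c d. term_integral k m (c, d)" UNIV _ c]
    by simp
  \<comment> \<open>The remainder is taken modulo |c|, the quotient with respect to c itself, so
    negative c needs no separate treatment.\<close>
  let ?i = "\<lambda>d. (d mod \<bar>c\<bar>, (d - d mod \<bar>c\<bar>) div c)"
  let ?j = "\<lambda>(r, q). r + c * q"
  let ?f = "\<lambda>(r, q). term_integral k m (c, r + c * q)"
  have cop: "coprime c (r + c * q) \<longleftrightarrow> coprime c r" for r q
    by (metis coprime_iff_gcd_eq_1 gcd_add_mult mult.commute add.commute)
  have dec: "d mod \<bar>c\<bar> + c * ((d - d mod \<bar>c\<bar>) div c) = d" for d
  proof -
    have "\<bar>c\<bar> dvd d - d mod \<bar>c\<bar>"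
      by (rule dvd_minus_mod)
    then have "c dvd d - d mod \<bar>c\<bar>"
      by (simp only: abs_dvd_iff)
    then show ?thesis
      by simp
  qed
  have w1: "?i (?j a) = a" if "a \<in> R \<times> UNIV" for a
    using that c by (auto simp: R_def residue_mod_abs)
  have w2: "?j a \<in> {d. coprime c d}" if "a \<in> R \<times> UNIV" for a
    using that cop by (auto simp: R_def)
  have w3: "?j (?i d) = d" if "d \<in> {d. coprime c d}" for d
    using dec by simp
  have w4: "?i d \<in> R \<times> UNIV" if "d \<in> {d. coprime c d}" for d
  proof -
    have "coprime c (d mod \<bar>c\<bar>)"
      using that cop[of "d mod \<bar>c\<bar>" "(d - d mod \<bar>c\<bar>) div c"] dec by simp
    then show ?thesis
      using c by (simp add: R_def)
  qed
  have bij: "bij_betw ?j (R \<times> UNIV) {d. coprime c d}"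
    by (rule bij_betw_byWitness[of _ ?i]; intro ballI image_subsetI) (fact w1 w3 w2 w4)+
  have w5: "term_integral k m (c, ?j a) = ?f a" for a
    by (simp add: case_prod_beta)
  have summ: "?f summable_on R \<times> UNIV"
    using row summable_on_reindex_bij_betw[OF bij, of "\<lambda>d. term_integral k m (c, d)"] by (simp only: w5)
  have "row_sum k m c = infsum ?f (R \<times> UNIV)"
    using infsum_reindex_bij_betw[OF bij, of "\<lambda>d. term_integral k m (c, d)"] by (simp only: w5 row_sum_def)
  also have "\<dots> = (\<Sum>\<^sub>\<infinity>r\<in>R. \<Sum>\<^sub>\<infinity>q. term_integral k m (c, r + c * q))"
    using infsum_Sigma_banach[OF summ] by simp
  also have "\<dots> = (\<Sum>r\<in>R. \<Sum>\<^sub>\<infinity>q. term_integral k m (c, r + c * q))"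
    using \<open>finite R\<close> by simp
  also have "\<dots> = (\<Sum>r\<in>R. phase m c r / of_int c ^ k * kern_lim k (of_int m / of_int c ^ 2))"
  proof (rule sum.cong[OF refl])
    fix r assume r: "r \<in> R"
    have "(\<lambda>q. term_integral k m (c, r + c * q)) summable_on UNIV"
      using summ summable_on_SigmaD1[of "\<lambda>r q. term_integral k m (c, r + c * q)" R "\<lambda>_. UNIV" r] r by simp
    then show "(\<Sum>\<^sub>\<infinity>q. term_integral k m (c, r + c * q)) = phase m c r / of_int c ^ k * kern_lim k (of_int m / of_int c ^ 2)"
      using k m c r by (intro infsum_residue_class) (auto simp: R_def)
  qed
  finally show ?thesis
    by (simp add: R_def sum_distrib_right sum_divide_distrib)
qed

text \<open>Modulo 1 the only residue is 0 and its phase is trivial; even weight removes the sign of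
  c = -1.\<close>

lemma row_sum_unit:
  assumes k: "4 \<le> k" "even k" and m: "0 \<le> m" and c: "\<bar>c\<bar> = 1"
  shows "row_sum k m c = kern_lim k (of_int m)"
proof -
  have c': "c = 1 \<or> c = - 1"
    using c by auto
  have rs: "{r. 0 \<le> r \<and> r < \<bar>c\<bar> \<and> coprime c r} = {0}"
    unfolding c using c' by auto
  have "e (of_int u / of_int c) = 1" for u
  proof -
    have "e (of_int u / of_int c) = e (of_int 0 / of_int c)"
      using c' by (intro e_cong) auto
    then show ?thesis
      by (simp add: e_def)
  qed
  then have ph: "phase m c 0 = 1"
    by (simp only: phase_def mult_1_right)
  have pw: "of_int c ^ k = (1 :: complex)" "of_int c ^ 2 = (1 :: real)"
    using c' k by auto
  have "c \<noteq> 0"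
    using c' by auto
  show ?thesis
    unfolding row_sum_eq[OF k(1) m \<open>c \<noteq> 0\<close>] rs pw by (simp add: ph)
qed

text \<open>The trivial bound |c| for the Kloosterman sum costs one power of |c|, leaving the
  exponent n = k - 1.\<close>

lemma norm_row_sum_le:
  assumes k: "4 \<le> Suc n" and m: "0 \<le> m" and c: "c \<noteq> 0"
  shows "norm (row_sum (Suc n) m c) \<le> norm (kern_lim (Suc n) (of_int m / of_int c ^ 2)) / \<bar>of_int c\<bar> ^ n"
proof -
  let ?R = "{r. 0 \<le> r \<and> r < \<bar>c\<bar> \<and> coprime c r}"
  have "norm (\<Sum>r\<in>?R. phase m c r) \<le> real (card ?R)"
    using norm_sum[of "phase m c" ?R] by (simp add: norm_phase)
  also have "card ?R \<le> card {0..<\<bar>c\<bar>}"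
    by (rule card_mono) auto
  finally have s: "norm (\<Sum>r\<in>?R. phase m c r) \<le> \<bar>of_int c\<bar>"
    by simp
  have "norm (row_sum (Suc n) m c) = norm (\<Sum>r\<in>?R. phase m c r) / \<bar>of_int c\<bar> ^ Suc n * norm (kern_lim (Suc n) (of_int m / of_int c ^ 2))"
    unfolding row_sum_eq[OF k m c] by (simp only: norm_mult norm_divide norm_power norm_of_int)
  also have "\<dots> \<le> \<bar>of_int c\<bar> / \<bar>of_int c\<bar> ^ Suc n * norm (kern_lim (Suc n) (of_int m / of_int c ^ 2))"
    using s by (intro mult_right_mono divide_right_mono) auto
  finally show ?thesis
    using c by simp
qed

lemma integral_e_line:
  fixes l :: int
  shows "integral {0..1} (\<lambda>x::real. e (of_int l * (of_real x + \<i>))) = (if l = 0 then 1 else 0)"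
proof (cases "l = 0")
  case True
  then show ?thesis
    by (simp add: e_def)
next
  case False
  let ?w = "2 * of_real pi * \<i> * of_int l :: complex"
  let ?F = "\<lambda>z. e (of_int l * (z + \<i>)) / ?w"
  have "((\<lambda>x::real. e (of_int l * (of_real x + \<i>))) has_integral ?F (of_real 1) - ?F (of_real 0)) {0..1}"
  proof (rule fundamental_theorem_of_calculus)
    fix x :: real
    have "(?F has_field_derivative e (of_int l * (of_real x + \<i>))) (at (of_real x))"
      unfolding e_def using False by (auto intro!: derivative_eq_intros)
    then show "((\<lambda>x::real. ?F (of_real x)) has_vector_derivative e (of_int l * (of_real x + \<i>))) (at x within {0..1})"
      by (rule has_vector_derivative_real_field)
  qed simp
  moreover have "e (of_int l * (of_real 1 + \<i>)) = e (of_int l * (of_real 0 + \<i>))"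
    using e_add[of "of_int l" "of_int l * \<i>"] by (simp add: e_of_int ring_distribs)
  ultimately show ?thesis
    using False by (simp add: integral_unique)
qed

text \<open>The rows (0,1) and (0,-1) both act as integer translations and, for even weight,
  contribute equally. The value 2 reflects that -I is not factored out; orthogonality of the
  exponentials singles out m = 1.\<close>

lemma row_sum_0:
  assumes "even k"
  shows "row_sum k m 0 = (if m = 1 then 2 else 0)"
proof -
  have "term_integral k m (0, d) = (if m = 1 then 1 else 0)" if d: "d = 1 \<or> d = - 1" for d
  proof -
    obtain a b where ab: "upper_row 0 d = (a, b)"
      by fastforce
    have "a * d = 1"
      using coprime_upper_row[of 0 d] d by (auto simp: ab)
    then have "a = d"
      using d by auto
    have "poincare_term k m (0, d) z * e (- z) = e (of_int (m - 1) * z)" for z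
    proof -
      have "of_int m * moeb a b 0 d z = of_int m * z + of_int (m * b * d)"
        using d \<open>a = d\<close> by (auto simp: moeb_def algebra_simps)
      then have "e (of_int m * moeb a b 0 d z) = e (of_int m * z)"
        by (simp only: e_add e_of_int mult_1_right)
      moreover have "e (of_int m * z) * e (- z) = e (of_int (m - 1) * z)"
        unfolding e_add[symmetric] by (simp add: algebra_simps)
      ultimately show ?thesis
        using d assms by (auto simp: poincare_term_def ab)
    qed
    then show ?thesis
      by (simp only: term_integral_def integral_e_line) simp
  qed
  moreover have "{d. coprime 0 d} = {1, - 1 :: int}"
    by auto
  ultimately show ?thesis
    by (simp add: row_sum_def)
qed

section \<open>The first Fourier coefficient\<close>

definition tail_const :: real where
  "tail_const = (\<Sum>\<^sub>\<infinity>c::int. 2 / (1 + of_int c ^ 2))"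

lemma tail_summable: "(\<lambda>c::int. 2 / (1 + of_int c ^ 2) :: real) summable_on UNIV"
  using summable_on_cmult_right[OF summable_on_int_inverse_square, of 2] by simp

lemma tail_const_nonneg: "0 \<le> tail_const"
  unfolding tail_const_def by (intro infsum_nonneg) simp

text \<open>Of the n factors |c|, all but two are bounded below by 2, and the remaining c^2 is at
  least (1 + c^2) / 2. This separates the decay 2^(-n) from a convergent sum over c.\<close>

lemma inverse_power_le_tail:
  fixes c :: int
  assumes "2 \<le> \<bar>c\<bar>" "2 \<le> n"
  shows "1 / \<bar>real_of_int c\<bar> ^ n \<le> 4 / 2 ^ n * (2 / (1 + of_int c ^ 2))"
proof -
  have c: "2 \<le> \<bar>real_of_int c\<bar>"
    using assms(1) by linarith
  obtain l where n: "n = l + 2"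
    using assms(2) by (metis add.commute le_Suc_ex)
  have "1 \<le> real_of_int c ^ 2"
    using power_mono[of 1 "\<bar>real_of_int c\<bar>" 2] c by simp
  then have "2 ^ l * ((1 + real_of_int c ^ 2) / 2) \<le> \<bar>real_of_int c\<bar> ^ l * \<bar>real_of_int c\<bar> ^ 2"
    using c by (intro mult_mono power_mono) auto
  also have "\<dots> = \<bar>real_of_int c\<bar> ^ n"
    by (simp only: n power_add)
  finally have "1 / \<bar>real_of_int c\<bar> ^ n \<le> 1 / (2 ^ l * ((1 + real_of_int c ^ 2) / 2))"
    by (intro divide_left_mono mult_pos_pos) (use c in \<open>auto intro!: add_pos_nonneg\<close>)
  then show ?thesis
    by (simp add: n power_add)
qed

text \<open>The rows c = 0, 1, -1 give the main terms exactly. For |c| >= 2 the kernel parameter m /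
  c^2 is at most m / 4, so one exponential bounds all remaining rows, and \<open>tail_const\<close>
  sums them.\<close>

lemma fourier_coeff_approx:
  assumes n: "3 \<le> n" and k: "even (Suc n)" and m: "0 \<le> m"
  shows "norm (fourier_coeff (poincare (Suc n) m 1) 1 - ((if m = 1 then 2 else 0) + 2 * kern_lim (Suc n) (of_int m))) \<le>
    4 / 2 ^ n * tail_const * ((2 * pi) ^ Suc n * exp (pi\<^sup>2 * of_int m / (real n + 1)) / fact n)"
proof -
  let ?C = "{c::int. 2 \<le> \<bar>c\<bar>}" and ?R = "row_sum (Suc n) m"
  let ?B = "(2 * pi) ^ Suc n * exp (pi\<^sup>2 * of_int m / (real n + 1)) / fact n"
  have k4: "4 \<le> Suc n"
    using n by simp
  have s: "term_integral (Suc n) m summable_on Sigma UNIV (\<lambda>c. {d. coprime c d})"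
    by (rule term_integral_summable[OF k4 m])
  have "fourier_coeff (poincare (Suc n) m 1) 1 = infsum (term_integral (Suc n) m) (Sigma UNIV (\<lambda>c. {d. coprime c d}))"
    using infsumI[OF has_sum_term_integral[OF k4 m, of 1]] by (simp only: bottom_rows_1)
  also have "\<dots> = infsum ?R UNIV"
    unfolding row_sum_def by (rule infsum_Sigma_banach[OF s, symmetric])
  finally have fc: "fourier_coeff (poincare (Suc n) m 1) 1 = infsum ?R UNIV" .
  have R: "?R summable_on UNIV"
    using summable_on_Sigma_banach[of "\<lambda>c d. term_integral (Suc n) m (c, d)" UNIV "\<lambda>c. {d. coprime c d}"] s
    by (simp add: row_sum_def[abs_def])
  then have RC: "?R summable_on ?C"
    by (rule summable_on_subset_banach) simp
  have "UNIV = {0, 1, - 1} \<union> ?C"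
    by auto
  then have "infsum ?R UNIV = infsum ?R {0, 1, - 1} + infsum ?R ?C"
    using infsum_Un_disjoint[of ?R "{0, 1, - 1}" ?C] RC by simp
  also have "infsum ?R {0, 1, - 1} = (if m = 1 then 2 else 0) + 2 * kern_lim (Suc n) (of_int m)"
    using row_sum_0[OF k] row_sum_unit[OF k4 k m, of 1] row_sum_unit[OF k4 k m, of "- 1"] by simp
  finally have eq: "fourier_coeff (poincare (Suc n) m 1) 1 - ((if m = 1 then 2 else 0) + 2 * kern_lim (Suc n) (of_int m)) = infsum ?R ?C"
    by (simp only: fc add_diff_cancel_left')
  have T: "(\<lambda>c::int. 4 / 2 ^ n * ?B * (2 / (1 + of_int c ^ 2))) summable_on UNIV"
    by (intro summable_on_cmult_right tail_summable)
  have "norm (infsum ?R ?C) \<le> (\<Sum>\<^sub>\<infinity>c\<in>?C. 4 / 2 ^ n * ?B * (2 / (1 + of_int c ^ 2)))"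
  proof (rule norm_infsum_le[OF has_sum_infsum[OF RC] has_sum_infsum])
    show "(\<lambda>c::int. 4 / 2 ^ n * ?B * (2 / (1 + of_int c ^ 2))) summable_on ?C"
      using T by (rule summable_on_subset_banach) simp
    fix c assume "c \<in> ?C"
    then have c: "2 \<le> \<bar>c\<bar>" "c \<noteq> 0"
      by auto
    have "4 \<le> real_of_int c ^ 2"
      using power_mono[of 2 "\<bar>real_of_int c\<bar>" 2] c by simp
    then have "real_of_int m / of_int c ^ 2 \<le> of_int m / 4"
      using m by (intro divide_left_mono) auto
    then have "4 * pi\<^sup>2 * (real_of_int m / of_int c ^ 2) \<le> 4 * pi\<^sup>2 * (of_int m / 4)"
      by (rule mult_left_mono) simp
    also have "\<dots> = pi\<^sup>2 * of_int m"
      by simp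
    finally have "exp (4 * pi\<^sup>2 * (real_of_int m / of_int c ^ 2) / (real n + 1)) \<le> exp (pi\<^sup>2 * of_int m / (real n + 1))"
      unfolding exp_le_cancel_iff by (rule divide_right_mono) simp
    then have "(2 * pi) ^ Suc n * exp (4 * pi\<^sup>2 * (of_int m / of_int c ^ 2) / (real n + 1)) / fact n \<le> ?B"
      by (intro divide_right_mono mult_left_mono) auto
    then have B: "norm (kern_lim (Suc n) (of_int m / of_int c ^ 2)) \<le> ?B"
      using m by (intro order_trans[OF norm_kern_lim_le]) auto
    have "norm (?R c) \<le> norm (kern_lim (Suc n) (of_int m / of_int c ^ 2)) / \<bar>of_int c\<bar> ^ n"
      by (rule norm_row_sum_le[OF k4 m c(2)])
    also have "\<dots> \<le> ?B / \<bar>of_int c\<bar> ^ n"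
      using B by (rule divide_right_mono) simp
    also have "\<dots> = ?B * (1 / \<bar>of_int c\<bar> ^ n)"
      by simp
    also have "\<dots> \<le> ?B * (4 / 2 ^ n * (2 / (1 + of_int c ^ 2)))"
      using n by (intro mult_left_mono inverse_power_le_tail[OF c(1)]) auto
    finally show "norm (?R c) \<le> 4 / 2 ^ n * ?B * (2 / (1 + of_int c ^ 2))"
      by (simp only: mult_ac)
  qed
  also have "\<dots> \<le> (\<Sum>\<^sub>\<infinity>c\<in>UNIV. 4 / 2 ^ n * ?B * (2 / (1 + of_int c ^ 2)))"
    by (rule infsum_mono_neutral) (use T summable_on_subset_banach in auto)
  also have "\<dots> = 4 / 2 ^ n * tail_const * ?B"
    unfolding tail_const_def using tail_summable by (subst infsum_cmult_right) (simp_all only: mult_ac)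
  finally show ?thesis
    unfolding eq .
qed

text \<open>Here the term from c = 0 is absent. A vanishing coefficient would force the main term 2
  A(m) below the tail; after cancelling (2 pi)^(n+1) / n! this contradicts
  \<open>large\<close>.\<close>

lemma fourier_coeff_nonzero_large:
  assumes n: "3 \<le> n" and k: "even (Suc n)" and m: "1 < m" "of_int m \<le> real n ^ 2 / (16 * pi\<^sup>2)"
    and large: "2 * tail_const * exp (9 / 16 * real n) < 2 ^ n"
  shows "fourier_coeff (poincare (Suc n) m 1) 1 \<noteq> 0"
proof
  let ?P = "(2 * pi) ^ Suc n / fact n"
  define t where "t = 4 * pi\<^sup>2 * real_of_int m"
  assume "fourier_coeff (poincare (Suc n) m 1) 1 = 0"
  then have up: "2 * norm (kern_lim (Suc n) (of_int m)) \<le> ?P * (4 / 2 ^ n * tail_const * exp (t / 4 / (real n + 1)))"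
    using fourier_coeff_approx[OF n k, of m] m by (simp add: norm_mult t_def mult_ac)
  \<comment> \<open>With n = k - 1, the bound on m in the theorem says exactly 4t <= n^2.\<close>
  have t: "0 \<le> t" "4 * t \<le> real n ^ 2"
    using m by (auto simp: t_def field_simps)
  have "real n ^ 2 \<le> (real n + 1) * (real n + 2)"
    by (simp add: power2_eq_square algebra_simps)
  with t have "?P * exp (- 2 * t / (real n + 1)) \<le> norm (kern_lim (Suc n) (of_int m))"
    using norm_kern_lim_ge[of "of_int m" n] m by (simp add: t_def mult_ac)
  then have "2 * (?P * exp (- 2 * t / (real n + 1))) \<le> ?P * (4 / 2 ^ n * tail_const * exp (t / 4 / (real n + 1)))"
    by (rule order_trans[OF mult_left_mono up]) simp
  then have "?P * (2 * exp (- 2 * t / (real n + 1))) \<le> ?P * (4 / 2 ^ n * tail_const * exp (t / 4 / (real n + 1)))"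
    by (simp only: mult.left_commute)
  then have "2 * exp (- 2 * t / (real n + 1)) \<le> 4 / 2 ^ n * tail_const * exp (t / 4 / (real n + 1))"
    by (subst (asm) mult_le_cancel_left_pos) auto
  then have "2 ^ n \<le> 2 * tail_const * (exp (t / 4 / (real n + 1)) * exp (2 * t / (real n + 1)))"
    by (simp add: exp_minus field_simps)
  \<comment> \<open>Lower bound and tail together give the exponent 2 + 1/4 = 9/4 times t / (n+1);
    with t <= n^2 / 4 it is at most 9n/16.\<close>
  also have "exp (t / 4 / (real n + 1)) * exp (2 * t / (real n + 1)) = exp (9 / 4 * t / (real n + 1))"
  proof -
    have "t / 4 / r + 2 * t / r = 9 / 4 * t / r" for r :: real
      by (cases "r = 0") (auto simp: field_simps)
    then show ?thesis
      unfolding exp_add[symmetric] by (simp only:)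
  qed
  also have "9 / 4 * t / (real n + 1) \<le> 9 / 16 * real n"
  proof -
    have "16 * (9 / 4 * t) \<le> 9 * real n * real n"
      using t by (simp add: power2_eq_square)
    also have "\<dots> \<le> 9 * real n * (real n + 1)"
      by (intro mult_left_mono) auto
    finally show ?thesis
      by (simp add: field_simps)
  qed
  then have "2 * tail_const * exp (9 / 4 * t / (real n + 1)) \<le> 2 * tail_const * exp (9 / 16 * real n)"
    using tail_const_nonneg by (intro mult_left_mono) auto
  finally show False
    using large by simp
qed

text \<open>For m = 1 the constant 2 from c = 0 dominates: by the triangle inequality a vanishing
  coefficient would bound 2 by the tail plus the rows c = 1, -1, which are small by
  \<open>large\<close>.\<close>

lemma fourier_coeff_nonzero_one:
  assumes n: "3 \<le> n" and k: "even (Suc n)"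
    and large: "(1 + 2 * tail_const) * (2 * pi * exp (4 * pi\<^sup>2)) * ((2 * pi) ^ n / fact n) < 1"
  shows "fourier_coeff (poincare (Suc n) 1 1) 1 \<noteq> 0"
proof
  let ?P = "(2 * pi) ^ Suc n / fact n"
  define Q where "Q = (1 + 2 * tail_const) * (2 * pi * exp (4 * pi\<^sup>2)) * ((2 * pi) ^ n / fact n)"
  assume "fourier_coeff (poincare (Suc n) 1 1) 1 = 0"
  then have "norm (2 + 2 * kern_lim (Suc n) 1) \<le> ?P * (4 / 2 ^ n * tail_const * exp (pi\<^sup>2 / (real n + 1)))"
    using fourier_coeff_approx[OF n k, of 1] norm_minus_cancel[of "2 + 2 * kern_lim (Suc n) 1"]
    by (simp add: mult_ac)
  also have "\<dots> \<le> ?P * (4 * tail_const * exp (4 * pi\<^sup>2))"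
  proof (rule mult_left_mono[OF mult_mono])
    have "(1::real) \<le> 2 ^ n"
      by simp
    then show "4 / 2 ^ n * tail_const \<le> 4 * tail_const"
      using tail_const_nonneg by (intro mult_right_mono) (auto simp: field_simps)
    have "pi\<^sup>2 / (real n + 1) \<le> pi\<^sup>2"
      by (simp add: field_simps)
    then show "exp (pi\<^sup>2 / (real n + 1)) \<le> exp (4 * pi\<^sup>2)"
      by (simp add: order_trans[of _ "pi\<^sup>2"])
  qed (use tail_const_nonneg in auto)
  finally have 1: "norm (2 + 2 * kern_lim (Suc n) 1) \<le> ?P * (4 * tail_const * exp (4 * pi\<^sup>2))" .
  have "norm (kern_lim (Suc n) 1) \<le> ?P * exp (4 * pi\<^sup>2 / (real n + 1))"
    using norm_kern_lim_le[of 1 n] by simp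
  also have "\<dots> \<le> ?P * exp (4 * pi\<^sup>2)"
    by (intro mult_left_mono) (auto simp: field_simps)
  finally have 2: "norm (2 * kern_lim (Suc n) 1) \<le> 2 * (?P * exp (4 * pi\<^sup>2))"
    by (simp add: norm_mult)
  have "norm (2 :: complex) \<le> norm (2 + 2 * kern_lim (Suc n) 1) + norm (2 * kern_lim (Suc n) 1)"
    using norm_triangle_ineq4[of "2 + 2 * kern_lim (Suc n) 1" "2 * kern_lim (Suc n) 1"] by simp
  also have "\<dots> \<le> ?P * (4 * tail_const * exp (4 * pi\<^sup>2)) + 2 * (?P * exp (4 * pi\<^sup>2))"
    using 1 2 by (rule add_mono)
  also have "\<dots> = 2 * Q"
    by (simp add: Q_def algebra_simps add_divide_distrib)
  finally show False
    using large unfolding Q_def[symmetric] by simp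
qed

section \<open>Growth estimates and the choice of the threshold\<close>

lemma eventually_large:
  "\<forall>\<^sub>F n in sequentially. 2 * C * exp (9 / 16 * real n) < 2 ^ n"
proof -
  \<comment> \<open>Numerically 9/16 < 2/3 <= ln 2, so exp(9/16) / 2 is the ratio of a null
    geometric sequence.\<close>
  have "9 / 16 < ln (2::real)"
    using ln2_ge_two_thirds by linarith
  then have "exp (9 / 16) < (2::real)"
    by (metis exp_less_cancel_iff exp_ln zero_less_numeral)
  then have "(\<lambda>n. (2 * C) * (exp (9 / 16) / 2) ^ n) \<longlonglongrightarrow> 0"
    by (intro tendsto_mult_right_zero LIMSEQ_realpow_zero) auto
  then have "\<forall>\<^sub>F n in sequentially. (2 * C) * (exp (9 / 16) / 2) ^ n < 1"
    by (rule order_tendstoD) simp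
  then show ?thesis
    by eventually_elim (simp add: power_divide exp_of_nat_mult[symmetric] field_simps)
qed

lemma eventually_small:
  "\<forall>\<^sub>F n in sequentially. C * ((x::real) ^ n / fact n) < 1"
proof -
  have "(\<lambda>n. x ^ n / fact n) \<longlonglongrightarrow> 0"
    using summable_LIMSEQ_zero[OF summable_exp[of x]] by (simp add: divide_inverse mult.commute)
  then have "(\<lambda>n. C * (x ^ n / fact n)) \<longlonglongrightarrow> 0"
    by (rule tendsto_mult_right_zero)
  then show ?thesis
    by (rule order_tendstoD) simp
qed

lemma v_infty_eq_1:
  assumes "fourier_coeff f 1 \<noteq> 0"
  shows "v_infty f = 1"
  unfolding v_infty_def using assms by (intro Least_equality) auto

lemma fourier_coeff_nonzeroD:
  assumes "fourier_coeff f n \<noteq> 0"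
  shows "\<exists>z. Im z > 0 \<and> f z \<noteq> 0"
proof (rule ccontr)
  assume "\<not> ?thesis"
  then have "f (of_real x + \<i>) = 0" for x
    by (metis Im_complex_of_real add.left_neutral imaginary_unit.simps(2) plus_complex.simps(2) zero_less_one)
  then show False
    using assms by (simp add: fourier_coeff_def)
qed

theorem theorem1:
  shows "\<exists>K0::nat. \<forall>k::nat. \<forall>m::int.
           even k \<and> k \<ge> K0 \<and> 1 \<le> m \<and> real_of_int m \<le> (real k - 1)^2 / (16 * pi^2)
           \<longrightarrow> v_infty (poincare k m 1) = 1 \<and> (\<exists>z. Im z > 0 \<and> poincare k m 1 z \<noteq> 0)"
proof -
  have "\<forall>\<^sub>F n in sequentially. 3 \<le> n \<and> 2 * tail_const * exp (9 / 16 * real n) < 2 ^ n \<and>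
      (1 + 2 * tail_const) * (2 * pi * exp (4 * pi\<^sup>2)) * ((2 * pi) ^ n / fact n) < 1"
    by (intro eventually_conj eventually_ge_at_top eventually_large eventually_small)
  then obtain N where N: "\<And>n. N \<le> n \<Longrightarrow> 3 \<le> n \<and> 2 * tail_const * exp (9 / 16 * real n) < 2 ^ n \<and>
      (1 + 2 * tail_const) * (2 * pi * exp (4 * pi\<^sup>2)) * ((2 * pi) ^ n / fact n) < 1"
    by (auto simp: eventually_sequentially)
  show ?thesis
  \<comment> \<open>The estimates are indexed by n = k - 1, hence the shift by one.\<close>
  proof (intro exI[of _ "Suc N"] allI impI)
    fix k :: nat and m :: int
    assume *: "even k \<and> k \<ge> Suc N \<and> 1 \<le> m \<and> real_of_int m \<le> (real k - 1)^2 / (16 * pi^2)"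
    then obtain n where n: "k = Suc n" "N \<le> n"
      by (metis Suc_le_D Suc_le_mono)
    have "fourier_coeff (poincare k m 1) 1 \<noteq> 0"
    proof (cases "m = 1")
      case True
      then show ?thesis
        using N[OF n(2)] * unfolding n(1) by (metis fourier_coeff_nonzero_one)
    next
      case False
      then show ?thesis
        using N[OF n(2)] * unfolding n(1) by (intro fourier_coeff_nonzero_large) auto
    qed
    then show "v_infty (poincare k m 1) = 1 \<and> (\<exists>z. Im z > 0 \<and> poincare k m 1 z \<noteq> 0)"
      by (intro conjI v_infty_eq_1 fourier_coeff_nonzeroD)
  qed
qed

end
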